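(* Let $\mu(de)=h(e)\,de$ be a signed measure on the space $\mathbf E$ of planes in $\mathbf R^3$ with continuous density $h$, and let its flag density $\rho$ be a $C^2$ function on the space of flags. Let $\mathrm A\subset\mathbf S^2$ be a spherical disc of spherical radius $\alpha<\pi/2$, and use spherical coordinates $(\varphi,\nu)$ on $\mathbf S^2$ with the centre of $\mathrm A$ as pole, so that $\partial\mathrm A=\{l=(\varphi,\alpha):0\le\varphi<2\pi\}$. Then $$2\pi\int_{\mathrm A}h^*(s)\,ds=\int_{\mathrm A}M(s)\,ds+\int_{\mathrm A}\frac{\partial M(s)}{\partial n}\,ds+\cos\alpha\int_0^{2\pi}M(l)\,d\varphi-\sin\alpha\int_0^{2\pi}\rho'_\Phi(l)\,d\varphi-2\cos\alpha\int_0^{2\pi}\rho(l)\,d\varphi-\sin\alpha\int_0^{2\pi}\rho'_y(l)\,d\varphi,$$ where $n$ is the outer normal direction to $\mathbf S^2$ at $s$, $ds$ is the area element of $\mathbf S^2$.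
   Context: $\mathbf E$ is the space of planes in $\mathbf R^3$, with invariant measure $de=dp\,d\xi$ ($p$ = distance from origin, $\xi\in\mathbf S^2$ = normal). For $x\in\mathbf R^3$, $h_x(\xi)=h(e_\xi)$ where $e_\xi$ is the plane through $x$ with normal $\xi$. A flag is $f=(x,g,e)$ ($x$ a point, $g\ni x$ a directed line, $e\supset g$ an oriented plane), equivalently $(x,\omega,\varphi)$ with $\omega$ the positive normal of $e$ and $\varphi$ the angle of $g$ in $e$. The flag density of $\mu$ is $\rho(x,\omega,\varphi)=\frac12\int_{\mathbf S^2}\cos^2(\varphi-\psi(\xi))h_x(\xi)\,d\xi$, $\psi(\xi)$ the angle of the orthogonal projection of $\xi$ onto the plane of the flag. The bundle mass is $M(x)=\frac12\int_{\mathbf S^2}h_x(\xi)\,d\xi$. For $s\in\mathbf S^2$, $h^*(s)=h(t(s))$ where $t(s)$ is the plane tangent to $\mathbf S^2$ at $s$. The tangent flag to $\mathrm A$ at $l\in\partial\mathrm A$ is the flag located at $l$ whose plane is tangent to $\mathbf S^2$ at $l$ with positive normal equal to the outer normal of $\mathbf S^2$, whose line is tangent to $\partial\mathrm A$ at $l$, directed so that motion along $\partial\mathrm A$ leaves $\mathrm A$ locally on the left; $\rho(l),\rho'_\Phi(l),\rho'_y(l)$ denote values at this flag. Axes of a flag: $x_1$ along $g$; $x_2$ in $e$, orthogonal to $x_1$, directed into the right half of $e$ bounded by $g$; $x_3$ along the positive normal; left triad. $\rho'_\Phi$ is the derivative under rotation of the flag around $g$ (positive = clockwise looking along $g$); $\rho'_y$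 is the derivative under translation of the location in direction $x_2$. *)

theory Defs
  imports "HOL-Analysis.Analysis"
begin

type_synonym vec3 = "real^3"

definition plane :: "vec3 \<Rightarrow> real \<Rightarrow> vec3 set" where
  "plane xi p = {y. xi \<bullet> y = p}"

definition sph :: "vec3 \<Rightarrow> vec3 \<Rightarrow> vec3 \<Rightarrow> real \<Rightarrow> real \<Rightarrow> vec3" where
  "sph c u v phi nu = cos nu *\<^sub>R c + sin nu *\<^sub>R (cos phi *\<^sub>R u + sin phi *\<^sub>R v)"

definition cap_integral :: "vec3 \<Rightarrow> vec3 \<Rightarrow> vec3 \<Rightarrow> real \<Rightarrow> (vec3 \<Rightarrow> real) \<Rightarrow> real" where
  "cap_integral c u v a f =
     integral {0..2*pi} (\<lambda>phi. integral {0..a} (\<lambda>nu. f (sph c u v phi nu) * sin nu))"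

definition sphere_integral :: "(vec3 \<Rightarrow> real) \<Rightarrow> real" where
  "sphere_integral f = cap_integral (axis 3 1) (axis 1 1) (axis 2 1) pi f"

definition hx :: "(vec3 set \<Rightarrow> real) \<Rightarrow> vec3 \<Rightarrow> vec3 \<Rightarrow> real" where
  "hx h x xi = h (plane xi (xi \<bullet> x))"

definition bundle_mass :: "(vec3 set \<Rightarrow> real) \<Rightarrow> vec3 \<Rightarrow> real" where
  "bundle_mass h x = 1/2 * sphere_integral (\<lambda>xi. hx h x xi)"

text \<open>h^*(s) = h(t(s)), t(s) the plane tangent to S^2 at s.\<close>
definition hstar :: "(vec3 set \<Rightarrow> real) \<Rightarrow> vec3 \<Rightarrow> real" where
  "hstar h s = h (plane s 1)"

text \<open>Flags (x, omega, g): location x, positive unit normal omega of the plane,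
  unit direction g of the line (g lies in the plane, i.e. orthogonal to omega).
  The angle phi of g in e is encoded by the vector g itself.\<close>
definition flags :: "(vec3 \<times> vec3 \<times> vec3) set" where
  "flags = {(x, w, g). norm w = 1 \<and> norm g = 1 \<and> w \<bullet> g = 0}"

text \<open>cos(phi - psi(xi)), where phi is the angle of g in the plane with normal w
  and psi(xi) the angle of the orthogonal projection of xi onto that plane.\<close>
definition cos_flag_angle :: "vec3 \<Rightarrow> vec3 \<Rightarrow> vec3 \<Rightarrow> real" where
  "cos_flag_angle w g xi =
     (let P = xi - (xi \<bullet> w) *\<^sub>R w in (g \<bullet> P) / norm P)"

definition flag_density :: "(vec3 set \<Rightarrow> real) \<Rightarrow> vec3 \<Rightarrow> vec3 \<Rightarrow> vec3 \<Rightarrow> real" where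
  "flag_density h x w g =
     1/2 * sphere_integral (\<lambda>xi. (cos_flag_angle w g xi)^2 * hx h x xi)"

definition C2_on :: "'a::euclidean_space set \<Rightarrow> ('a \<Rightarrow> real) \<Rightarrow> bool" where
  "C2_on U F \<longleftrightarrow>
     (\<exists>F' :: 'a \<Rightarrow> 'a \<Rightarrow>\<^sub>L real. \<exists>F'' :: 'a \<Rightarrow> 'a \<Rightarrow>\<^sub>L ('a \<Rightarrow>\<^sub>L real).
        (\<forall>z\<in>U. (F has_derivative blinfun_apply (F' z)) (at z)) \<and>
        (\<forall>z\<in>U. (F' has_derivative blinfun_apply (F'' z)) (at z)) \<and>
        continuous_on U F'')"

text \<open>A function on the flag manifold is C^2 iff it extends to a C^2 function
  on an open neighbourhood of the (closed embedded) flag manifold in R^9.\<close>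
definition C2_on_flags :: "(vec3 \<Rightarrow> vec3 \<Rightarrow> vec3 \<Rightarrow> real) \<Rightarrow> bool" where
  "C2_on_flags r \<longleftrightarrow>
     (\<exists>U F. open U \<and> flags \<subseteq> U \<and> C2_on U F \<and>
            (\<forall>x w g. (x, w, g) \<in> flags \<longrightarrow> F (x, w, g) = r x w g))"

text \<open>Derivative under rotation of the flag around g (positive = clockwise
  looking along g, i.e. right-handed rotation about g).\<close>
definition rho_Phi :: "(vec3 \<Rightarrow> vec3 \<Rightarrow> vec3 \<Rightarrow> real) \<Rightarrow> vec3 \<Rightarrow> vec3 \<Rightarrow> vec3 \<Rightarrow> real" where
  "rho_Phi r x w g = deriv (\<lambda>t. r x (cos t *\<^sub>R w + sin t *\<^sub>R cross3 g w) g) 0"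

text \<open>Derivative under translation in direction x_2 = g \<times> omega (left triad
  x_1 = g, x_2, x_3 = omega).\<close>
definition rho_y :: "(vec3 \<Rightarrow> vec3 \<Rightarrow> vec3 \<Rightarrow> real) \<Rightarrow> vec3 \<Rightarrow> vec3 \<Rightarrow> vec3 \<Rightarrow> real" where
  "rho_y r x w g = deriv (\<lambda>t. r (x + t *\<^sub>R cross3 g w) w g) 0"

text \<open>Direction of the tangent flag at boundary point l of the disc centred at c
  (A on the left when viewed from the outer normal side).\<close>
definition tangent_dir :: "vec3 \<Rightarrow> vec3 \<Rightarrow> vec3" where
  "tangent_dir c l = (1 / norm (cross3 c l)) *\<^sub>R cross3 c l"

end

theory Submission
  imports Defs
begin

text \<open>
  Write \<open>H(\<xi>, p)\<close> for the density at the plane \<open>{y. \<xi> \<bullet> y = p}\<close> and \<open>P(a)\<close> for the integral of \<open>\<rho>\<close> over the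
  tangent flags of the circle of spherical radius \<open>a\<close>. Moving along a meridian both translates the
  flag and rotates it around its line, so \<open>P'(a)\<close> is the integral of \<open>\<rho>'\<^sub>\<Phi> + \<rho>'\<^sub>y\<close>; moreover
  \<open>M(s) + \<partial>M/\<partial>n\<close> is the derivative of \<open>r M(r s)\<close> at \<open>r = 1\<close>. Hence the claim, multiplied by \<open>sin a\<close>, is obtained by
  differentiating in \<open>a\<close> and in \<open>r\<close> an identity without derivatives, which makes sense for
  merely continuous \<open>H\<close>. That identity is linear in \<open>H\<close> and, by Fubini, it suffices to prove it for the
  contribution of each fixed normal \<open>\<xi>\<close>; by Weierstrass approximation \<open>H(\<xi>, \<cdot>)\<close> may be taken to be a
  monomial. With \<open>t = \<xi> \<bullet> s\<close>, monomials of degree \<open>n\<close> and \<open>n + 2\<close> differ by the factor \<open>1 - t\<^sup>2\<close>, which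
  cancels the singularity of the kernel and leaves the divergence theorem on the cap; degrees 0 and 1
  are Poisson kernel integrals.
\<close>

section \<open>Poisson kernel integrals over the circle\<close>

text \<open>Two obstacles shape the proof. First, H is only continuous, so no derivative may fall on
  it, and the differentiability of M has to come from \<rho>. For the monomial p^n the identity at a
  fixed location carries a factor n + 1, that is, a derivative of H. Integrating the location along
  the ray from 0 to L s divides by n + 1 and leaves the value H(\<xi>, L p) instead. Differentiation
  happens only after all normals have been integrated. Second, the squared cosine in the flag
  density is discontinuous where \<xi> is, up to sign, the normal of the flag. For fixed \<xi> this
  shows up as absolute values |cos a - z| and |cos a + z| in the Poisson integrals, where z is the
  inner product of \<xi> with the centre. They turn into positive parts that live on those normals
  for which \<xi> or -\<xi> lies in the disc. There H is taken at distance r, and at r = 1 these are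
  the planes tangent to the sphere: this is the origin of the \<open>hstar\<close> term. The weight
  cos \<nu> - cos a arises from one integration by parts, and the derivative in a turns it into sin
  a.\<close>

lemma poisson_integral:
  fixes x y s A D :: real
  assumes "A > 0" "D > 0" "A\<^sup>2 - D\<^sup>2 = s\<^sup>2 * (x\<^sup>2 + y\<^sup>2)"
  shows "((\<lambda>\<phi>. D / (A - s * (x * cos \<phi> + y * sin \<phi>))) has_integral 2 * pi) {0..2*pi}"
proof -
  \<comment> \<open>In complex terms, zeta = k (x - iy) e^(i \<phi>) has real part \<open>X\<close>,
    imaginary part \<open>- Y\<close> and squared modulus \<open>r\<close>. The choice of
    \<open>k\<close> turns the integrand into the Poisson kernel (1 - |zeta|^2) / |1 -
    zeta|^2.\<close>
  define k where "k = s / (A + D)"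
  define X where "X = (\<lambda>\<phi>. k * (x * cos \<phi> + y * sin \<phi>))"
  define Y where "Y = (\<lambda>\<phi>. k * (y * cos \<phi> - x * sin \<phi>))"
  define r where "r = k\<^sup>2 * (x\<^sup>2 + y\<^sup>2)"
  have AD: "A + D > 0" using assms by simp
  have r: "r = (A - D) / (A + D)"
  proof -
    have "k * (A + D) = s" using AD by (simp add: k_def)
    hence "r * (A + D)\<^sup>2 = s\<^sup>2 * (x\<^sup>2 + y\<^sup>2)" unfolding r_def by (auto simp: power_mult_distrib)
    hence "r * (A + D) * (A + D) = (A - D) * (A + D)"
      using assms(3) by (simp add: power2_eq_square algebra_simps)
    hence "r * (A + D) = A - D" using AD by simp
    thus ?thesis using AD by (simp add: eq_divide_eq)
  qed
  have r1: "r < 1" using assms AD by (simp add: r)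
  have XY: "(X \<phi>)\<^sup>2 + (Y \<phi>)\<^sup>2 = r" for \<phi>
  proof -
    have "(X \<phi>)\<^sup>2 + (Y \<phi>)\<^sup>2 = k\<^sup>2 * (x\<^sup>2 + y\<^sup>2) * ((sin \<phi>)\<^sup>2 + (cos \<phi>)\<^sup>2)"
      unfolding X_def Y_def by algebra
    thus ?thesis by (simp add: r_def)
  qed
  have X1: "X \<phi> < 1" for \<phi>
  proof -
    have "(X \<phi>)\<^sup>2 < 1" using XY[of \<phi>] r1 zero_le_power2[of "Y \<phi>"] by linarith
    thus ?thesis using power_less_imp_less_base[of "X \<phi>" 2 1] by simp
  qed
  have dX: "(X has_real_derivative Y \<phi>) (at \<phi> within S)" for \<phi> S
    unfolding X_def Y_def by (auto intro!: derivative_eq_intros simp: algebra_simps)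
  have dY: "(Y has_real_derivative - X \<phi>) (at \<phi> within S)" for \<phi> S
    unfolding X_def Y_def by (auto intro!: derivative_eq_intros simp: algebra_simps)
  have key: "1 - 2 * ((r - X \<phi>) / ((1 - X \<phi>)\<^sup>2 + (Y \<phi>)\<^sup>2)) = D / (A - s * (x * cos \<phi> + y * sin \<phi>))" for \<phi>
  proof -
    have den: "(1 - X \<phi>)\<^sup>2 + (Y \<phi>)\<^sup>2 = 1 - 2 * X \<phi> + r"
      using XY[of \<phi>] by (simp add: power2_eq_square algebra_simps)
    have pos: "(1 - X \<phi>)\<^sup>2 + (Y \<phi>)\<^sup>2 > 0" using X1[of \<phi>] by (simp add: add_pos_nonneg)
    have e1: "1 - 2 * X \<phi> + r = 2 * (A - s * (x * cos \<phi> + y * sin \<phi>)) / (A + D)"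
    proof -
      have "1 + r = 2 * A / (A + D)" using AD by (simp add: r field_simps)
      thus ?thesis using AD by (simp add: X_def k_def diff_divide_distrib)
    qed
    have e2: "1 - r = 2 * D / (A + D)" using AD by (simp add: r field_simps)
    have "1 - 2 * ((r - X \<phi>) / ((1 - X \<phi>)\<^sup>2 + (Y \<phi>)\<^sup>2)) = (1 - r) / (1 - 2 * X \<phi> + r)"
      using pos unfolding den by (simp add: field_simps)
    also have "\<dots> = D / (A - s * (x * cos \<phi> + y * sin \<phi>))"
    proof -
      have "(2 * D / (A + D)) / (2 * E / (A + D)) = D / E" for E using AD by simp
      thus ?thesis unfolding e1 e2 .
    qed
    finally show ?thesis .
  qed
  \<comment> \<open>The antiderivative is \<phi> - 2 Arg (1 - zeta). Since 1 - zeta has positive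
    real part, the arctangent is a continuous branch of the argument, and its contributions at 0 and
    2 pi cancel.\<close>
  have "((\<lambda>\<phi>. 1 - 2 * ((r - X \<phi>) / ((1 - X \<phi>)\<^sup>2 + (Y \<phi>)\<^sup>2))) has_integral
      ((2*pi) - 2 * arctan (Y (2*pi) / (1 - X (2*pi)))) - (0 - 2 * arctan (Y 0 / (1 - X 0)))) {0..2*pi}"
  proof (rule fundamental_theorem_of_calculus)
    fix \<phi>
    have n: "1 - X \<phi> \<noteq> 0" using X1[of \<phi>] by simp
    have "((\<lambda>\<phi>. \<phi> - 2 * arctan (Y \<phi> / (1 - X \<phi>))) has_real_derivative
       1 - 2 * (inverse (1 + (Y \<phi> / (1 - X \<phi>))\<^sup>2) * ((- X \<phi> * (1 - X \<phi>) - Y \<phi> * (0 - Y \<phi>)) / ((1 - X \<phi>) * (1 - X \<phi>)))))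
       (at \<phi> within {0..2*pi})"
      using n by (auto intro!: derivative_eq_intros dX dY)
    moreover have "inverse (1 + (Y \<phi> / (1 - X \<phi>))\<^sup>2) * ((- X \<phi> * (1 - X \<phi>) - Y \<phi> * (0 - Y \<phi>)) / ((1 - X \<phi>) * (1 - X \<phi>)))
       = (r - X \<phi>) / ((1 - X \<phi>)\<^sup>2 + (Y \<phi>)\<^sup>2)"
    proof -
      have "1 + (Y \<phi> / (1 - X \<phi>))\<^sup>2 = ((1 - X \<phi>)\<^sup>2 + (Y \<phi>)\<^sup>2) / (1 - X \<phi>)\<^sup>2"
        using n by (simp add: power_divide field_simps)
      moreover have "- X \<phi> * (1 - X \<phi>) - Y \<phi> * (0 - Y \<phi>) = r - X \<phi>"
        using XY[of \<phi>] by (simp add: power2_eq_square algebra_simps)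
      ultimately show ?thesis using n by (simp add: power2_eq_square)
    qed
    ultimately show "((\<lambda>\<phi>. \<phi> - 2 * arctan (Y \<phi> / (1 - X \<phi>))) has_vector_derivative
       1 - 2 * ((r - X \<phi>) / ((1 - X \<phi>)\<^sup>2 + (Y \<phi>)\<^sup>2))) (at \<phi> within {0..2*pi})"
      by (simp only: has_real_derivative_iff_has_vector_derivative)
  qed simp
  thus ?thesis unfolding key by (simp add: X_def Y_def)
qed

lemma cos_sin_combination:
  fixes x y :: real
  obtains \<psi> where "x = sqrt (x\<^sup>2 + y\<^sup>2) * cos \<psi>" "y = sqrt (x\<^sup>2 + y\<^sup>2) * sin \<psi>"
proof -
  have "rcis (cmod (Complex x y)) (Arg (Complex x y)) = Complex x y"
    by (rule rcis_cmod_Arg)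
  hence "x = cmod (Complex x y) * cos (Arg (Complex x y)) \<and> y = cmod (Complex x y) * sin (Arg (Complex x y))"
    by (metis Re_rcis Im_rcis complex.sel)
  thus ?thesis by (intro that[of "Arg (Complex x y)"]) (simp_all add: cmod_def)
qed

text \<open>The numerator is (A - s q)(A + s q) - D^2, so the quotient is A + s q, whose integral is
  2 pi A, minus D times the Poisson integrand.\<close>

lemma poisson_weighted_integral:
  fixes x y s A D :: real
  assumes A: "A > 0" and D: "D \<ge> 0" and AD: "A\<^sup>2 - D\<^sup>2 = s\<^sup>2 * (x\<^sup>2 + y\<^sup>2)"
  shows "((\<lambda>\<phi>. (s * (y * cos \<phi> - x * sin \<phi>))\<^sup>2 / (A - s * (x * cos \<phi> + y * sin \<phi>))) has_integral 2 * pi * (A - D)) {0..2*pi}"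
proof -
  define q where "q = (\<lambda>\<phi>. x * cos \<phi> + y * sin \<phi>)"
  define q' where "q' = (\<lambda>\<phi>. y * cos \<phi> - x * sin \<phi>)"
  have qq: "(s * q' \<phi>)\<^sup>2 = (A - s * q \<phi>) * (A + s * q \<phi>) - D\<^sup>2" for \<phi>
  proof -
    have "(q \<phi>)\<^sup>2 + (q' \<phi>)\<^sup>2 = (x\<^sup>2 + y\<^sup>2) * ((sin \<phi>)\<^sup>2 + (cos \<phi>)\<^sup>2)"
      unfolding q_def q'_def by algebra
    hence "(q \<phi>)\<^sup>2 + (q' \<phi>)\<^sup>2 = x\<^sup>2 + y\<^sup>2" by simp
    hence "A\<^sup>2 - D\<^sup>2 = s\<^sup>2 * ((q \<phi>)\<^sup>2 + (q' \<phi>)\<^sup>2)" using AD by simp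
    thus ?thesis by (simp add: power2_eq_square algebra_simps)
  qed
  have iq: "((\<lambda>\<phi>. A + s * q \<phi>) has_integral 2 * pi * A) {0..2*pi}"
  proof -
    have "((\<lambda>\<phi>. A + s * q \<phi>) has_integral (A * (2*pi) + s * (x * sin (2*pi) - y * cos (2*pi)))
        - (A * 0 + s * (x * sin 0 - y * cos 0))) {0..2*pi}"
      by (rule fundamental_theorem_of_calculus)
        (auto intro!: derivative_eq_intros simp: q_def has_real_derivative_iff_has_vector_derivative[symmetric] algebra_simps)
    thus ?thesis by (simp add: algebra_simps)
  qed
  show ?thesis
  proof (cases "D = 0")
    case False
    hence D0: "D > 0" using D by simp
    have ne: "A - s * q \<phi> \<noteq> 0" for \<phi>
    proof
      assume "A - s * q \<phi> = 0"
      hence "(s * q' \<phi>)\<^sup>2 = - D\<^sup>2" using qq[of \<phi>] by simp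
      moreover have "D\<^sup>2 > 0" "(s * q' \<phi>)\<^sup>2 \<ge> 0" using D0 by auto
      ultimately show False by linarith
    qed
    have "((\<lambda>\<phi>. A + s * q \<phi> - D * (D / (A - s * q \<phi>))) has_integral 2 * pi * A - D * (2 * pi)) {0..2*pi}"
      using has_integral_diff[OF iq has_integral_mult_right[OF poisson_integral[OF A D0 AD], of D]]
      by (simp add: q_def)
    moreover have "A + s * q \<phi> - D * (D / (A - s * q \<phi>)) = (s * q' \<phi>)\<^sup>2 / (A - s * q \<phi>)" for \<phi>
      unfolding qq using ne[of \<phi>] by (simp add: field_simps power2_eq_square)
    ultimately show ?thesis by (simp add: q_def q'_def algebra_simps)
  next
    \<comment> \<open>Here the denominator can vanish; in the application this means that \<xi> or
      -\<xi> lies on the circle. The zeros form a countable set, and off this set the quotient is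
      just A + s q.\<close>
    case True
    obtain \<psi> where psi: "x = sqrt (x\<^sup>2 + y\<^sup>2) * cos \<psi>" "y = sqrt (x\<^sup>2 + y\<^sup>2) * sin \<psi>"
      by (rule cos_sin_combination)
    define w where "w = sqrt (x\<^sup>2 + y\<^sup>2)"
    have qw: "q \<phi> = w * cos (\<phi> - \<psi>)" for \<phi>
      unfolding q_def by (subst psi(1), subst psi(2)) (simp add: w_def cos_diff algebra_simps)
    have w2: "w\<^sup>2 = x\<^sup>2 + y\<^sup>2" by (simp add: w_def)
    have sw: "A\<^sup>2 = (s * w)\<^sup>2" using AD True by (simp add: w2 power_mult_distrib)
    have "{\<phi>. A - s * q \<phi> = 0} \<subseteq> (\<lambda>k::int. \<psi> + of_int k * pi) ` UNIV"
    proof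
      fix \<phi> assume "\<phi> \<in> {\<phi>. A - s * q \<phi> = 0}"
      hence "A = s * w * cos (\<phi> - \<psi>)" by (simp add: qw algebra_simps)
      hence "A\<^sup>2 = (s * w)\<^sup>2 * (cos (\<phi> - \<psi>))\<^sup>2" by (simp only: power_mult_distrib)
      hence "A\<^sup>2 = A\<^sup>2 * (cos (\<phi> - \<psi>))\<^sup>2" by (simp only: sw[symmetric])
      hence "(cos (\<phi> - \<psi>))\<^sup>2 = 1" using A by simp
      hence "sin (\<phi> - \<psi>) = 0" using sin_cos_squared_add[of "\<phi> - \<psi>"] by simp
      then obtain k :: int where "\<phi> - \<psi> = of_int k * pi" unfolding sin_zero_iff_int2 by (elim exE)
      hence "\<phi> = \<psi> + of_int k * pi" by simp
      thus "\<phi> \<in> (\<lambda>k::int. \<psi> + of_int k * pi) ` UNIV" by (rule image_eqI) simp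
    qed
    hence "countable {\<phi>. A - s * q \<phi> = 0}"
      by (rule countable_subset) simp
    hence neg: "negligible {\<phi>. A - s * q \<phi> = 0}" 
      by (simp add: negligible_iff_null_sets null_sets_completionI countable_imp_null_set_lborel)
    have "((\<lambda>\<phi>. (s * q' \<phi>)\<^sup>2 / (A - s * q \<phi>)) has_integral 2 * pi * A) {0..2*pi}"
      by (rule has_integral_spike[OF neg _ iq]) (simp add: qq True)
    thus ?thesis by (simp add: True q_def q'_def)
  qed
qed

section \<open>Moments of a fixed normal over circles and caps\<close>

lemma real_integral_swap:
  fixes f :: "real \<Rightarrow> real \<Rightarrow> real"
  assumes "continuous_on ({a..b} \<times> {c..d}) (\<lambda>z. f (fst z) (snd z))"
  shows "integral {a..b} (\<lambda>x. integral {c..d} (f x)) = integral {c..d} (\<lambda>y. integral {a..b} (\<lambda>x. f x y))"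
  using integral_swap_continuous[of a c b d f] assms
  by (simp add: cbox_Pair_eq case_prod_unfold)

lemma continuous_on_real_integral_param:
  fixes f :: "'a::topological_space \<Rightarrow> real \<Rightarrow> real"
  assumes "continuous_on (U \<times> {c..d}) (\<lambda>z. f (fst z) (snd z))"
  shows "continuous_on U (\<lambda>x. integral {c..d} (f x))"
  using integral_continuous_on_param[of U c d f] assms by (simp add: case_prod_unfold)

lemma integral_deriv_eq:
  fixes F f :: "real \<Rightarrow> real"
  assumes "a \<le> b" "\<And>x. (F has_real_derivative f x) (at x)"
  shows "integral {a..b} f = F b - F a"
  by (intro integral_unique fundamental_theorem_of_calculus assms)
    (auto simp: has_real_derivative_iff_has_vector_derivative[symmetric] intro: has_field_derivative_at_within assms)

text \<open>
  \<open>(z, x, y)\<close> are the coordinates of a unit vector \<open>\<xi>\<close> in an orthonormal frame (pole first), and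
  \<open>t \<nu> \<phi> = \<xi> \<bullet> s\<close> for the point \<open>s\<close> with spherical coordinates \<open>(\<phi>, \<nu>)\<close>; \<open>t'\<close> and \<open>q'\<close> are the
  components of its spherical gradient along the meridian and the parallel.
\<close>

locale sphere_point =
  fixes z x y :: real
  assumes unit: "z\<^sup>2 + x\<^sup>2 + y\<^sup>2 = 1"
begin

definition q where "q \<phi> = x * cos \<phi> + y * sin \<phi>"
definition q' where "q' \<phi> = y * cos \<phi> - x * sin \<phi>"
definition t where "t \<nu> \<phi> = z * cos \<nu> + sin \<nu> * q \<phi>"
definition t' where "t' \<nu> \<phi> = cos \<nu> * q \<phi> - z * sin \<nu>"

lemma q_deriv [derivative_intros]: "(f has_real_derivative d) (at u within S) \<Longrightarrow>
    ((\<lambda>u. q (f u)) has_real_derivative q' (f u) * d) (at u within S)"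
  unfolding q_def q'_def by (auto intro!: derivative_eq_intros simp: algebra_simps)

lemma q'_deriv [derivative_intros]: "(f has_real_derivative d) (at u within S) \<Longrightarrow>
    ((\<lambda>u. q' (f u)) has_real_derivative - q (f u) * d) (at u within S)"
  unfolding q_def q'_def by (auto intro!: derivative_eq_intros simp: algebra_simps)

lemma q_cont [continuous_intros]: "continuous_on (S :: 'z::metric_space set) f \<Longrightarrow> continuous_on S (\<lambda>u. q (f u))"
  and q'_cont [continuous_intros]: "continuous_on S f \<Longrightarrow> continuous_on S (\<lambda>u. q' (f u))"
  unfolding q_def q'_def by (auto intro!: continuous_intros)

lemma t_cont [continuous_intros]:
    "continuous_on (S :: 'z::metric_space set) f \<Longrightarrow> continuous_on S g \<Longrightarrow> continuous_on S (\<lambda>u. t (f u) (g u))"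
  and t'_cont [continuous_intros]:
    "continuous_on S f \<Longrightarrow> continuous_on S g \<Longrightarrow> continuous_on S (\<lambda>u. t' (f u) (g u))"
  unfolding t_def t'_def by (auto intro!: continuous_intros)

lemma t_deriv [derivative_intros]: "(f has_real_derivative d) (at u within S) \<Longrightarrow>
    ((\<lambda>u. t (f u) \<phi>) has_real_derivative t' (f u) \<phi> * d) (at u within S)"
  unfolding t_def t'_def by (auto intro!: derivative_eq_intros simp: algebra_simps)

lemma t'_deriv [derivative_intros]: "(f has_real_derivative d) (at u within S) \<Longrightarrow>
    ((\<lambda>u. t' (f u) \<phi>) has_real_derivative - t (f u) \<phi> * d) (at u within S)"
  unfolding t_def t'_def by (auto intro!: derivative_eq_intros simp: algebra_simps)

lemma t_deriv_azimuth [derivative_intros]: "(f has_real_derivative d) (at u within S) \<Longrightarrow>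
    ((\<lambda>u. t \<nu> (f u)) has_real_derivative sin \<nu> * q' (f u) * d) (at u within S)"
  unfolding t_def by (auto intro!: derivative_eq_intros simp: algebra_simps)

lemma t'_deriv_azimuth [derivative_intros]: "(f has_real_derivative d) (at u within S) \<Longrightarrow>
    ((\<lambda>u. t' \<nu> (f u)) has_real_derivative cos \<nu> * q' (f u) * d) (at u within S)"
  unfolding t'_def by (auto intro!: derivative_eq_intros simp: algebra_simps)

lemma q_periodic: "q (2*pi) = q 0" "q' (2*pi) = q' 0"
  by (simp_all add: q_def q'_def)

lemma q_q': "(q \<phi>)\<^sup>2 + (q' \<phi>)\<^sup>2 = 1 - z\<^sup>2"
proof -
  have "(q \<phi>)\<^sup>2 + (q' \<phi>)\<^sup>2 = (x\<^sup>2 + y\<^sup>2) * ((sin \<phi>)\<^sup>2 + (cos \<phi>)\<^sup>2)"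
    unfolding q_def q'_def by algebra
  thus ?thesis using unit by simp
qed

lemma t_t': "(t \<nu> \<phi>)\<^sup>2 + (t' \<nu> \<phi>)\<^sup>2 + (q' \<phi>)\<^sup>2 = 1"
proof -
  have "(t \<nu> \<phi>)\<^sup>2 + (t' \<nu> \<phi>)\<^sup>2 = (z\<^sup>2 + (q \<phi>)\<^sup>2) * ((sin \<nu>)\<^sup>2 + (cos \<nu>)\<^sup>2)"
    unfolding t_def t'_def by algebra
  thus ?thesis using q_q'[of \<phi>] by simp
qed

lemma abs_t_le: "\<bar>t \<nu> \<phi>\<bar> \<le> 1"
proof -
  have "(t \<nu> \<phi>)\<^sup>2 \<le> 1" using t_t'[of \<nu> \<phi>] zero_le_power2[of "t' \<nu> \<phi>"] zero_le_power2[of "q' \<phi>"] by linarith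
  thus ?thesis by (simp add: abs_square_le_1)
qed

lemma z_le: "\<bar>z\<bar> \<le> 1"
proof -
  have "z\<^sup>2 \<le> 1" using q_q'[of 0] zero_le_power2[of "q 0"] zero_le_power2[of "q' 0"] by linarith
  thus ?thesis by (simp add: abs_square_le_1)
qed

section \<open>Powers of t over circles and caps\<close>

definition moment where "moment n \<nu> = integral {0..2*pi} (\<lambda>\<phi>. t \<nu> \<phi> ^ n)"
text \<open>
  \<open>flux n\<close> is the flux of the field \<open>t\<^sup>n\<^sup>+\<^sup>1 \<nabla>t\<close> through a parallel; the divergence of this field is
  \<open>(n + 1) t\<^sup>n - (n + 3) t\<^sup>n\<^sup>+\<^sup>2\<close>.
\<close>

definition flux where "flux n \<nu> = sin \<nu> * integral {0..2*pi} (\<lambda>\<phi>. t \<nu> \<phi> ^ (n + 1) * t' \<nu> \<phi>)"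
definition div_flux where
  "div_flux n \<nu> = sin \<nu> * ((n + 1) * moment n \<nu> - (n + 3) * moment (n + 2) \<nu>)"

lemma moment_cont [continuous_intros]:
  "continuous_on (S :: 'z::metric_space set) f \<Longrightarrow> continuous_on S (\<lambda>u. moment n (f u))"
  unfolding moment_def
  by (rule continuous_on_real_integral_param)
    (auto intro!: continuous_intros intro: continuous_on_compose2[OF _ continuous_on_fst])

lemma flux_cont [continuous_intros]:
  "continuous_on (S :: 'z::metric_space set) f \<Longrightarrow> continuous_on S (\<lambda>u. flux n (f u))"
  unfolding flux_def
  by (intro continuous_intros continuous_on_real_integral_param)
    (auto intro!: continuous_intros intro: continuous_on_compose2[OF _ continuous_on_fst])

text \<open>The divergence theorem on the cap; the divergence formula rests on |grad t|^2 = 1 - t^2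
  and on t having spherical Laplacian -2t. Because the azimuthal derivative of t is sin \<nu> times
  q', the azimuthal term contains no division by sin \<nu>, and the pole needs no separate
  treatment.\<close>

lemma flux_eq:
  assumes "a \<ge> 0"
  shows "flux n a = integral {0..a} (div_flux n)"
proof -
  define e where "e = (\<lambda>\<nu> \<phi>. sin \<nu> * ((n + 1) * t \<nu> \<phi> ^ n - (n + 3) * t \<nu> \<phi> ^ (n + 2)))"
  \<comment> \<open>\<open>p\<close> is a \<open>\<phi>\<close>-derivative, hence integrates to 0 over the circle.\<close>
  define p where "p = (\<lambda>\<nu> \<phi>. (n + 1) * t \<nu> \<phi> ^ n * (sin \<nu> * q' \<phi>) * q' \<phi> - t \<nu> \<phi> ^ (n + 1) * q \<phi>)"
  have d1: "((\<lambda>\<nu>. sin \<nu> * (t \<nu> \<phi> ^ (n + 1) * t' \<nu> \<phi>)) has_real_derivative e \<nu> \<phi> - p \<nu> \<phi>) (at \<nu>)" for \<nu> \<phi>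
  proof -
    have "((\<lambda>\<nu>. sin \<nu> * (t \<nu> \<phi> ^ (n + 1) * t' \<nu> \<phi>)) has_real_derivative
       cos \<nu> * (t \<nu> \<phi> ^ (n + 1) * t' \<nu> \<phi>) + sin \<nu> * ((n + 1) * t \<nu> \<phi> ^ n * (t' \<nu> \<phi>)\<^sup>2 - t \<nu> \<phi> ^ (n+1) * t \<nu> \<phi>)) (at \<nu>)"
      by (auto intro!: derivative_eq_intros simp: power2_eq_square algebra_simps) (cases n, auto)
    moreover have "cos \<nu> * (t \<nu> \<phi> ^ (n + 1) * t' \<nu> \<phi>) + sin \<nu> * ((n + 1) * t \<nu> \<phi> ^ n * (t' \<nu> \<phi>)\<^sup>2 - t \<nu> \<phi> ^ (n+1) * t \<nu> \<phi>)
       = e \<nu> \<phi> - p \<nu> \<phi>"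
    proof -
      have a: "(t' \<nu> \<phi>)\<^sup>2 = 1 - (t \<nu> \<phi>)\<^sup>2 - (q' \<phi>)\<^sup>2" using t_t'[of \<nu> \<phi>] by simp
      have b: "cos \<nu> * t' \<nu> \<phi> = q \<phi> - sin \<nu> * t \<nu> \<phi>"
      proof -
        have "cos \<nu> * t' \<nu> \<phi> + sin \<nu> * t \<nu> \<phi> = q \<phi> * ((sin \<nu>)\<^sup>2 + (cos \<nu>)\<^sup>2)"
          unfolding t_def t'_def by algebra
        thus ?thesis by simp
      qed
      have "cos \<nu> * (t \<nu> \<phi> ^ (n + 1) * t' \<nu> \<phi>) = t \<nu> \<phi> ^ (n + 1) * (cos \<nu> * t' \<nu> \<phi>)" by simp
      thus ?thesis unfolding e_def p_def a b
        by (simp add: algebra_simps power2_eq_square)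
    qed
    ultimately show ?thesis by simp
  qed
  have p0: "integral {0..2*pi} (p \<nu>) = 0" for \<nu>
  proof -
    have "integral {0..2*pi} (p \<nu>) = t \<nu> (2*pi) ^ (n+1) * q' (2*pi) - t \<nu> 0 ^ (n+1) * q' 0"
      by (rule integral_deriv_eq)
        (auto simp: p_def algebra_simps intro!: derivative_eq_intros, (cases n, auto)?)
    thus ?thesis by (simp add: q_periodic t_def)
  qed
  have [continuous_intros]: "continuous_on S f \<Longrightarrow> continuous_on S g \<Longrightarrow> continuous_on S (\<lambda>u. e (f u) (g u))"
    "continuous_on S f \<Longrightarrow> continuous_on S g \<Longrightarrow> continuous_on S (\<lambda>u. p (f u) (g u))"
    for f g and S :: "'z::metric_space set"
    unfolding e_def p_def by (auto intro!: continuous_intros)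
  have ie: "integral {0..2*pi} (e \<nu>) = div_flux n \<nu>" for \<nu>
    unfolding e_def div_flux_def moment_def
    by (subst integral_mult_right, subst integral_diff)
      (auto intro!: integrable_continuous_real continuous_intros)
  have "flux n a = integral {0..2*pi} (\<lambda>\<phi>. integral {0..a} (\<lambda>\<nu>. e \<nu> \<phi> - p \<nu> \<phi>))"
    unfolding flux_def integral_mult_right[symmetric]
    by (subst integral_deriv_eq[OF assms d1]) simp
  also have "\<dots> = integral {0..a} (\<lambda>\<nu>. integral {0..2*pi} (\<lambda>\<phi>. e \<nu> \<phi> - p \<nu> \<phi>))"
    by (rule real_integral_swap) (intro continuous_intros)
  also have "\<dots> = integral {0..a} (div_flux n)"
    by (subst integral_diff) (auto simp: ie p0 intro!: integrable_continuous_real continuous_intros)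
  finally show ?thesis .
qed

text \<open>Again a flux through the parallel, now of the field t^n (sin \<nu> q') times the
  gradient of t turned by a right angle. The turned gradient is divergence-free and orthogonal to
  the gradient of t^n, so only the derivative of sin \<nu> q' along it survives in the divergence:
  this is cos \<nu> - z t.\<close>

lemma circle_integral_eq:
  assumes "a \<ge> 0"
  shows "integral {0..2*pi} (\<lambda>\<phi>. (sin a * q' \<phi>)\<^sup>2 * t a \<phi> ^ n) =
     integral {0..a} (\<lambda>\<nu>. (cos \<nu> - cos a) * div_flux n \<nu> + sin \<nu> * cos \<nu> * (moment n \<nu> - moment (n + 2) \<nu>))"
proof -
  define e where "e = (\<lambda>\<nu> \<phi>. sin \<nu> * t \<nu> \<phi> ^ n * (cos \<nu> - z * t \<nu> \<phi>))"
  define p where "p = (\<lambda>\<nu> \<phi>. sin \<nu> * (n * t \<nu> \<phi> ^ (n - 1) * (sin \<nu> * q' \<phi>) * q' \<phi> * t' \<nu> \<phi> - t \<nu> \<phi> ^ n * q \<phi> * t' \<nu> \<phi>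
      + t \<nu> \<phi> ^ n * q' \<phi> * (cos \<nu> * q' \<phi>)))"
  have d1: "((\<lambda>\<nu>. (sin \<nu> * q' \<phi>)\<^sup>2 * t \<nu> \<phi> ^ n) has_real_derivative e \<nu> \<phi> + p \<nu> \<phi>) (at \<nu>)" for \<nu> \<phi>
  proof -
    have "((\<lambda>\<nu>. (sin \<nu> * q' \<phi>)\<^sup>2 * t \<nu> \<phi> ^ n) has_real_derivative
       2 * (sin \<nu> * q' \<phi>) * (cos \<nu> * q' \<phi>) * t \<nu> \<phi> ^ n + (sin \<nu> * q' \<phi>)\<^sup>2 * (n * t \<nu> \<phi> ^ (n - 1) * t' \<nu> \<phi>)) (at \<nu>)"
      by (auto intro!: derivative_eq_intros simp: power2_eq_square algebra_simps)
    moreover have "2 * (sin \<nu> * q' \<phi>) * (cos \<nu> * q' \<phi>) * t \<nu> \<phi> ^ n + (sin \<nu> * q' \<phi>)\<^sup>2 * (n * t \<nu> \<phi> ^ (n - 1) * t' \<nu> \<phi>)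
       = e \<nu> \<phi> + p \<nu> \<phi>"
    proof -
      have "cos \<nu> * (q' \<phi>)\<^sup>2 + q \<phi> * t' \<nu> \<phi> = cos \<nu> * ((q \<phi>)\<^sup>2 + (q' \<phi>)\<^sup>2) - z * sin \<nu> * q \<phi>"
        unfolding t'_def by algebra
      also have "\<dots> = cos \<nu> - z * t \<nu> \<phi>"
        unfolding q_q' t_def by algebra
      finally have b: "cos \<nu> - z * t \<nu> \<phi> = cos \<nu> * (q' \<phi>)\<^sup>2 + q \<phi> * t' \<nu> \<phi>" ..
      show ?thesis unfolding e_def p_def b
        by (simp add: algebra_simps power2_eq_square)
    qed
    ultimately show ?thesis by simp
  qed
  have p0: "integral {0..2*pi} (p \<nu>) = 0" for \<nu>
  proof -
    have "integral {0..2*pi} (p \<nu>) = sin \<nu> * (t \<nu> (2*pi) ^ n * q' (2*pi) * t' \<nu> (2*pi)) - sin \<nu> * (t \<nu> 0 ^ n * q' 0 * t' \<nu> 0)"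
      by (rule integral_deriv_eq)
        (auto simp: p_def algebra_simps intro!: derivative_eq_intros)
    thus ?thesis by (simp add: q_periodic t_def t'_def)
  qed
  have [continuous_intros]: "continuous_on S f \<Longrightarrow> continuous_on S g \<Longrightarrow> continuous_on S (\<lambda>u. e (f u) (g u))"
    "continuous_on S f \<Longrightarrow> continuous_on S g \<Longrightarrow> continuous_on S (\<lambda>u. p (f u) (g u))"
    for f g and S :: "'z::metric_space set"
    unfolding e_def p_def by (auto intro!: continuous_intros)
  \<comment> \<open>The relation sin \<nu> t' = cos \<nu> t - z trades the coordinate z for t'. This
    makes \<open>flux\<close> appear, and by \<open>flux_eq\<close> everything reduces to
    moments.\<close>
  have ie: "integral {0..2*pi} (e \<nu>) = sin \<nu> * (flux n \<nu> + cos \<nu> * (moment n \<nu> - moment (n + 2) \<nu>))" for \<nu>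
  proof -
    have "sin \<nu> * (flux n \<nu> + cos \<nu> * (moment n \<nu> - moment (n + 2) \<nu>)) =
       integral {0..2*pi} (\<lambda>\<phi>. sin \<nu> * (sin \<nu> * (t \<nu> \<phi> ^ (n + 1) * t' \<nu> \<phi>) + cos \<nu> * (t \<nu> \<phi> ^ n - t \<nu> \<phi> ^ (n + 2))))"
      unfolding flux_def moment_def
      by (subst integral_mult_right, subst integral_add, (auto intro!: integrable_continuous_real continuous_intros)[2],
         subst integral_mult_right, subst integral_mult_right, subst integral_diff)
        (auto intro!: integrable_continuous_real continuous_intros)
    also have "\<dots> = integral {0..2*pi} (e \<nu>)"
    proof (rule integral_cong)
      fix \<phi>
      have "sin \<nu> * t' \<nu> \<phi> = cos \<nu> * t \<nu> \<phi> - z * ((sin \<nu>)\<^sup>2 + (cos \<nu>)\<^sup>2)"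
        unfolding t_def t'_def by algebra
      hence b: "sin \<nu> * t' \<nu> \<phi> = cos \<nu> * t \<nu> \<phi> - z" by simp
      have "sin \<nu> * (sin \<nu> * (t \<nu> \<phi> ^ (n + 1) * t' \<nu> \<phi>) + cos \<nu> * (t \<nu> \<phi> ^ n - t \<nu> \<phi> ^ (n + 2)))
        = sin \<nu> * (t \<nu> \<phi> ^ (n + 1) * (sin \<nu> * t' \<nu> \<phi>) + cos \<nu> * (t \<nu> \<phi> ^ n - t \<nu> \<phi> ^ (n + 2)))"
        by simp
      thus "sin \<nu> * (sin \<nu> * (t \<nu> \<phi> ^ (n + 1) * t' \<nu> \<phi>) + cos \<nu> * (t \<nu> \<phi> ^ n - t \<nu> \<phi> ^ (n + 2))) = e \<nu> \<phi>"
        unfolding e_def b by (simp add: algebra_simps)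
    qed
    finally show ?thesis ..
  qed
  \<comment> \<open>The antiderivative of sin \<nu> is normalized to vanish at \<open>a\<close>, and
    the flux vanishes at the pole, so there is no boundary term. This is where the weight cos \<nu>
    - cos a enters.\<close>
  have by_parts: "integral {0..a} (\<lambda>\<nu>. sin \<nu> * flux n \<nu>) = integral {0..a} (\<lambda>\<nu>. (cos \<nu> - cos a) * div_flux n \<nu>)"
  proof -
    have dfc: "continuous_on S (div_flux n)" for S
      unfolding div_flux_def by (intro continuous_intros)
    have fd: "(flux n has_real_derivative div_flux n \<nu>) (at \<nu> within {0..a})" if "\<nu> \<in> {0..a}" for \<nu>
    proof -
      have "((\<lambda>u. integral {0..u} (div_flux n)) has_real_derivative div_flux n \<nu>) (at \<nu> within {0..a})"
        by (rule integral_has_real_derivative[OF dfc that])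
      thus ?thesis
        by (rule has_field_derivative_transform_within[where d = 1]) (use that in \<open>auto simp: flux_eq\<close>)
    qed
    have "((\<lambda>\<nu>. (cos \<nu> - cos a) * div_flux n \<nu> - sin \<nu> * flux n \<nu>) has_integral
       (cos a - cos a) * flux n a - (cos 0 - cos a) * flux n 0) {0..a}"
      by (rule fundamental_theorem_of_calculus[OF assms])
        (auto simp: has_real_derivative_iff_has_vector_derivative[symmetric] algebra_simps intro!: derivative_eq_intros fd)
    hence "integral {0..a} (\<lambda>\<nu>. (cos \<nu> - cos a) * div_flux n \<nu> - sin \<nu> * flux n \<nu>) = 0"
      by (simp add: integral_unique flux_def)
    thus ?thesis
      by (subst (asm) integral_diff) (auto intro!: integrable_continuous_real continuous_intros dfc)
  qed
  have "integral {0..2*pi} (\<lambda>\<phi>. (sin a * q' \<phi>)\<^sup>2 * t a \<phi> ^ n) =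
       integral {0..2*pi} (\<lambda>\<phi>. integral {0..a} (\<lambda>\<nu>. e \<nu> \<phi> + p \<nu> \<phi>))"
    by (subst integral_deriv_eq[OF assms d1]) simp
  also have "\<dots> = integral {0..a} (\<lambda>\<nu>. integral {0..2*pi} (\<lambda>\<phi>. e \<nu> \<phi> + p \<nu> \<phi>))"
    by (rule real_integral_swap) (intro continuous_intros)
  also have "\<dots> = integral {0..a} (\<lambda>\<nu>. sin \<nu> * flux n \<nu> + sin \<nu> * cos \<nu> * (moment n \<nu> - moment (n + 2) \<nu>))"
    by (subst integral_add) (auto simp: ie p0 distrib_left mult.assoc intro!: integrable_continuous_real continuous_intros)
  also have "\<dots> = integral {0..a} (\<lambda>\<nu>. (cos \<nu> - cos a) * div_flux n \<nu> + sin \<nu> * cos \<nu> * (moment n \<nu> - moment (n + 2) \<nu>))"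
    unfolding div_flux_def
    by (subst (1 2) integral_add) (auto simp: by_parts[unfolded div_flux_def] intro!: integrable_continuous_real continuous_intros)
  finally show ?thesis .
qed

lemma flux_pi: "flux n pi = 0"
  by (simp add: flux_def)

lemma moment_0: "moment 0 \<nu> = 2 * pi"
  by (simp add: moment_def)

lemma moment_1: "moment 1 \<nu> = 2 * pi * (z * cos \<nu>)"
proof -
  have "moment 1 \<nu> = (z * cos \<nu> * (2*pi) - sin \<nu> * q' (2*pi)) - (z * cos \<nu> * 0 - sin \<nu> * q' 0)"
    unfolding moment_def
    by (rule integral_deriv_eq) (auto simp: t_def intro!: derivative_eq_intros)
  thus ?thesis by (simp add: q_periodic)
qed

text \<open>The flux through the antipole is 0, so \<open>flux_eq\<close> at pi is a recursion from
  n to n + 2. The result does not involve x, y, z: this is the source of the frame independence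
  shown later.\<close>

lemma sphere_moment:
  "integral {0..pi} (\<lambda>\<nu>. moment n \<nu> * sin \<nu>) = (if even n then 4 * pi / (n + 1) else 0)"
proof (induction n rule: less_induct)
  case (less n)
  consider "n = 0" | "n = 1" | m where "n = m + 2"
    by (metis One_nat_def Suc_eq_plus1 add_2_eq_Suc' not0_implies_Suc)
  thus ?case
  proof cases
    case 1
    have "integral {0..pi} (\<lambda>\<nu>. 2 * pi * sin \<nu>) = (- (2 * pi * cos pi)) - (- (2 * pi * cos 0))"
      by (rule integral_deriv_eq) (auto intro!: derivative_eq_intros)
    thus ?thesis by (simp add: 1 moment_0)
  next
    case 2
    have "integral {0..pi} (\<lambda>\<nu>. 2 * pi * (z * cos \<nu>) * sin \<nu>) = pi * z * (sin pi)\<^sup>2 - pi * z * (sin 0)\<^sup>2"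
      by (rule integral_deriv_eq) (auto intro!: derivative_eq_intros)
    thus ?thesis using moment_1 by (simp add: 2)
  next
    case (3 m)
    have "0 = integral {0..pi} (div_flux m)"
      using flux_eq[of pi m] by (simp add: flux_pi)
    also have "\<dots> = integral {0..pi} (\<lambda>\<nu>. (m + 1) * (moment m \<nu> * sin \<nu>) - (m + 3) * (moment (m + 2) \<nu> * sin \<nu>))"
      unfolding div_flux_def by (rule integral_cong) (simp add: algebra_simps)
    also have "\<dots> = (m + 1) * integral {0..pi} (\<lambda>\<nu>. moment m \<nu> * sin \<nu>)
        - (m + 3) * integral {0..pi} (\<lambda>\<nu>. moment (m + 2) \<nu> * sin \<nu>)"
      by (subst integral_diff, (auto intro!: integrable_continuous_real continuous_intros)[2],
          subst (1 2) integral_mult_right) simp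
    finally have "(m + 3) * integral {0..pi} (\<lambda>\<nu>. moment (m + 2) \<nu> * sin \<nu>)
        = (m + 1) * (if even m then 4 * pi / (m + 1) else 0)"
      using less[of m] 3 by simp
    also have "\<dots> = (m + 3) * (if even m then 4 * pi / (m + 3) else 0)" by simp
    finally show ?thesis by (simp add: 3)
  qed
qed

text \<open>This is sin^2 a times the squared cosine of the flag density at the flag tangent to the
  circle of radius a. The numerator vanishes wherever the denominator does, so with division by zero
  giving 0 the algebraic relations below hold at t = 1 and t = -1 too.\<close>

definition kern where "kern a \<phi> = (sin a * q' \<phi>)\<^sup>2 / (1 - (t a \<phi>)\<^sup>2)"

lemma q'_square_le: "(q' \<phi>)\<^sup>2 \<le> 1 - (t a \<phi>)\<^sup>2"
  using t_t'[of a \<phi>] zero_le_power2[of "t' a \<phi>"] by linarith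

lemma kern_mult: "kern a \<phi> * (1 - (t a \<phi>)\<^sup>2) = (sin a * q' \<phi>)\<^sup>2"
  using q'_square_le[of \<phi> a] by (cases "1 - (t a \<phi>)\<^sup>2 = 0") (simp_all add: kern_def)

lemma kern_nonneg: "kern a \<phi> \<ge> 0"
  using q'_square_le[of \<phi> a] zero_le_power2[of "q' \<phi>"] unfolding kern_def
  by (intro divide_nonneg_nonneg) (simp, linarith)

text \<open>Partial fractions of 1 / (1 - t^2) and t / (1 - t^2). In these two degrees no polynomial
  remainder occurs, and each fraction is a weighted Poisson integrand.\<close>

lemma kern_split: "kern a \<phi> * t a \<phi> ^ n = 
   ((sin a * q' \<phi>)\<^sup>2 / (1 - t a \<phi>) + (- 1) ^ n * ((sin a * q' \<phi>)\<^sup>2 / (1 + t a \<phi>))) / 2"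
  if "n = 0 \<or> n = 1"
proof (cases "1 - (t a \<phi>)\<^sup>2 = 0")
  case True
  thus ?thesis using q'_square_le[of \<phi> a] by (simp add: kern_def)
next
  case False
  have e: "1 - (t a \<phi>)\<^sup>2 = (1 - t a \<phi>) * (1 + t a \<phi>)" by (simp add: power2_eq_square algebra_simps)
  hence "1 - t a \<phi> \<noteq> 0" "1 + t a \<phi> \<noteq> 0" using False by auto
  thus ?thesis using that unfolding kern_def e by (auto simp: divide_simps) (auto simp: algebra_simps)
qed

lemma kern_base:
  assumes "n = 0 \<or> n = 1" "0 < a" "a < pi"
  shows "((\<lambda>\<phi>. kern a \<phi> * t a \<phi> ^ n) has_integral
     pi * ((1 - z * cos a - \<bar>cos a - z\<bar>) + (- 1) ^ n * (1 + z * cos a - \<bar>cos a + z\<bar>))) {0..2*pi}"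
proof -
  have "(cos a)\<^sup>2 < 1"
    using sin_squared_eq[of a] sin_gt_zero[OF assms(2,3)] zero_less_power[of "sin a" 2] by linarith
  hence c1: "\<bar>cos a\<bar> < 1" by (simp add: abs_square_less_1)
  hence "\<bar>z * cos a\<bar> < 1"
    using z_le mult_mono[of "\<bar>z\<bar>" 1 "\<bar>cos a\<bar>" "\<bar>cos a\<bar>"] by (simp add: abs_mult)
  hence pos: "1 - z * cos a > 0" "1 + z * cos a > 0" by auto
  have xy: "x\<^sup>2 + y\<^sup>2 = 1 - z\<^sup>2" using unit by simp
  \<comment> \<open>The two Poisson data: A = 1 - z cos a with D = |cos a - z| for \<xi>, and A = 1
    + z cos a with D = |cos a + z| for -\<xi>. Each difference of squares is (1 - z^2) sin^2
    a.\<close>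
  have e: "(1 - z * cos a)\<^sup>2 - \<bar>cos a - z\<bar>\<^sup>2 = (sin a)\<^sup>2 * (x\<^sup>2 + y\<^sup>2)"
    "(1 + z * cos a)\<^sup>2 - \<bar>cos a + z\<bar>\<^sup>2 = (sin a)\<^sup>2 * ((- x)\<^sup>2 + (- y)\<^sup>2)"
    unfolding power2_minus xy power2_abs sin_squared_eq by (simp_all add: power2_eq_square algebra_simps)
  have i1: "((\<lambda>\<phi>. (sin a * q' \<phi>)\<^sup>2 / (1 - t a \<phi>)) has_integral 2 * pi * (1 - z * cos a - \<bar>cos a - z\<bar>)) {0..2*pi}"
    using poisson_weighted_integral[OF pos(1) abs_ge_zero e(1)]
    by (simp add: q'_def t_def q_def algebra_simps)
  have "(sin a * (- y * cos \<phi> - - x * sin \<phi>))\<^sup>2 / (1 + z * cos a - sin a * (- x * cos \<phi> + - y * sin \<phi>))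
      = (sin a * q' \<phi>)\<^sup>2 / (1 + t a \<phi>)" for \<phi>
  proof -
    have "sin a * (- y * cos \<phi> - - x * sin \<phi>) = - (sin a * q' \<phi>)"
      "1 + z * cos a - sin a * (- x * cos \<phi> + - y * sin \<phi>) = 1 + t a \<phi>"
      by (simp_all add: q'_def t_def q_def algebra_simps)
    thus ?thesis by (simp only: power2_minus)
  qed
  hence i2: "((\<lambda>\<phi>. (sin a * q' \<phi>)\<^sup>2 / (1 + t a \<phi>)) has_integral 2 * pi * (1 + z * cos a - \<bar>cos a + z\<bar>)) {0..2*pi}"
    using poisson_weighted_integral[OF pos(2) abs_ge_zero e(2)] by simp
  show ?thesis
    unfolding kern_split[OF assms(1)]
    using has_integral_divide[OF has_integral_add[OF i1 has_integral_mult_right[OF i2, of "(- 1) ^ n"]], of 2]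
    by (rule has_integral_eq_rhs) (simp add: field_simps)
qed

lemma kern_integrable:
  assumes "0 < a" "a < pi"
  shows "kern a absolutely_integrable_on {0..2*pi}"
  using kern_base[of 0, OF _ assms] kern_nonneg
  by (intro nonnegative_absolutely_integrable_1) (auto simp: integrable_on_def)

lemma kern_mult_integrable:
  assumes "0 < a" "a < pi" "continuous_on {0..2*pi} (f :: real \<Rightarrow> real)"
  shows "(\<lambda>\<phi>. kern a \<phi> * f \<phi>) integrable_on {0..2*pi}"
proof -
  have "(\<lambda>\<phi>. f \<phi> * kern a \<phi>) absolutely_integrable_on {0..2*pi}"
    by (intro absolutely_integrable_bounded_measurable_product_real kern_integrable assms
        continuous_imp_measurable_on_sets_lebesgue compact_imp_bounded compact_continuous_image) auto
  thus ?thesis by (simp add: mult.commute set_lebesgue_integral_eq_integral(1))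
qed

definition cap where
  "cap a G = integral {0..2*pi} (\<lambda>\<phi>. integral {0..a} (\<lambda>\<nu>. G \<nu> (t \<nu> \<phi>) * sin \<nu>))"

lemma cap_swap:
  assumes "continuous_on ({0..a} \<times> {-1..1}) (\<lambda>p. G (fst p) (snd p))"
  shows "cap a G = integral {0..a} (\<lambda>\<nu>. integral {0..2*pi} (\<lambda>\<phi>. G \<nu> (t \<nu> \<phi>)) * sin \<nu>)"
proof -
  have [continuous_intros]: "continuous_on ({0..2*pi} \<times> {0..a}) (\<lambda>p. G (snd p) (t (snd p) (fst p)))"
    by (rule continuous_on_compose2[OF assms, where f = "\<lambda>p. (snd p, t (snd p) (fst p))", simplified])
      (auto intro!: continuous_intros simp: abs_t_le abs_le_iff[symmetric] minus_le_iff dest: abs_le_D1 abs_le_D2,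
       metis abs_t_le abs_le_iff minus_le_iff, metis abs_t_le abs_le_iff)
  show ?thesis unfolding cap_def
    by (subst real_integral_swap) (auto intro!: continuous_intros)
qed

text \<open>The induction goes by steps of two: kern times 1 - t^2 has no singularity, so the
  difference of degrees n and n + 2 is \<open>circle_integral_eq\<close>. The \<open>max\<close>
  terms depend only on the parity of n, cancel in this difference, and are thus determined by the
  two Poisson cases.\<close>

lemma kern_moment:
  assumes "0 < a" "a < pi"
  shows "integral {0..2*pi} (\<lambda>\<phi>. kern a \<phi> * t a \<phi> ^ n) =
     integral {0..a} (\<lambda>\<nu>. sin \<nu> * (((real n + 1) * (cos \<nu> - cos a) + cos \<nu>) * moment n \<nu>))
     - 2 * pi * (max 0 (z - cos a) + (- 1) ^ n * max 0 (- z - cos a))"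
proof (induction n rule: less_induct)
  case (less n)
  have max_abs: "max 0 (z - cos a) = (\<bar>cos a - z\<bar> + (z - cos a)) / 2"
    "max 0 (- z - cos a) = (\<bar>cos a + z\<bar> - (cos a + z)) / 2"
    by (auto simp: max_def)
  consider "n = 0" | "n = 1" | m where "n = m + 2"
    by (metis One_nat_def Suc_eq_plus1 add_2_eq_Suc' not0_implies_Suc)
  thus ?case
  proof cases
    case 1
    have A: "integral {0..a} (\<lambda>\<nu>. sin \<nu> * (((real n + 1) * (cos \<nu> - cos a) + cos \<nu>) * moment n \<nu>))
       = 2 * pi * (cos a * cos a - (cos a)\<^sup>2) - 2 * pi * (cos a * cos 0 - (cos 0)\<^sup>2)"
      using assms unfolding 1 moment_0 by (intro integral_deriv_eq) (auto intro!: derivative_eq_intros simp: power2_eq_square algebra_simps)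
    have B: "integral {0..2*pi} (\<lambda>\<phi>. kern a \<phi> * t a \<phi> ^ n) = pi * ((1 - z * cos a - \<bar>cos a - z\<bar>) + (- 1) ^ n * (1 + z * cos a - \<bar>cos a + z\<bar>))"
      by (rule integral_unique[OF kern_base]) (use 1 assms in auto)
    show ?thesis unfolding A B max_abs
      by (simp add: 1) (simp add: power2_eq_square field_simps)
  next
    case 2
    have A: "integral {0..a} (\<lambda>\<nu>. sin \<nu> * (((real n + 1) * (cos \<nu> - cos a) + cos \<nu>) * moment n \<nu>))
       = 2 * pi * z * (cos a * (cos a)\<^sup>2 - (cos a) ^ 3) - 2 * pi * z * (cos a * (cos 0)\<^sup>2 - (cos 0) ^ 3)"
      using assms moment_1 unfolding 2 by (intro integral_deriv_eq) (auto intro!: derivative_eq_intros simp: power2_eq_square algebra_simps)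
    have B: "integral {0..2*pi} (\<lambda>\<phi>. kern a \<phi> * t a \<phi> ^ n) = pi * ((1 - z * cos a - \<bar>cos a - z\<bar>) + (- 1) ^ n * (1 + z * cos a - \<bar>cos a + z\<bar>))"
      by (rule integral_unique[OF kern_base]) (use 2 assms in auto)
    show ?thesis unfolding A B max_abs
      by (simp add: 2) (simp add: power2_eq_square power3_eq_cube field_simps)
  next
    case (3 m)
    have "integral {0..2*pi} (\<lambda>\<phi>. kern a \<phi> * t a \<phi> ^ m) - integral {0..2*pi} (\<lambda>\<phi>. kern a \<phi> * t a \<phi> ^ (m + 2))
       = integral {0..2*pi} (\<lambda>\<phi>. (sin a * q' \<phi>)\<^sup>2 * t a \<phi> ^ m)"
    proof -
      have "(sin a * q' \<phi>)\<^sup>2 * t a \<phi> ^ m = kern a \<phi> * t a \<phi> ^ m - kern a \<phi> * t a \<phi> ^ (m + 2)" for \<phi>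
        unfolding kern_mult[symmetric] by (simp add: algebra_simps power2_eq_square)
      thus ?thesis
        by (simp only:) (intro integral_diff[symmetric] kern_mult_integrable assms continuous_intros)
    qed
    also have "\<dots> = integral {0..a} (\<lambda>\<nu>. sin \<nu> * (((real m + 1) * (cos \<nu> - cos a) + cos \<nu>) * moment m \<nu>)
        - sin \<nu> * (((real n + 1) * (cos \<nu> - cos a) + cos \<nu>) * moment n \<nu>))"
      using assms by (subst circle_integral_eq) (auto simp: div_flux_def 3 algebra_simps intro!: integral_cong)
    also have "\<dots> = integral {0..a} (\<lambda>\<nu>. sin \<nu> * (((real m + 1) * (cos \<nu> - cos a) + cos \<nu>) * moment m \<nu>))
        - integral {0..a} (\<lambda>\<nu>. sin \<nu> * (((real n + 1) * (cos \<nu> - cos a) + cos \<nu>) * moment n \<nu>))"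
      by (rule integral_diff) (auto intro!: integrable_continuous_real continuous_intros)
    finally show ?thesis using less[of m] 3 by simp
  qed
qed

end

section \<open>The identity for a single normal\<close>

text \<open>Linearity is asked for continuous arguments only, because the intended \<open>T\<close>
  are built from gauge integrals, which are additive only on integrable functions. The bound makes
  \<open>T\<close> continuous for uniform convergence.\<close>

lemma weierstrass_functional_eq_0:
  fixes T :: "(real \<Rightarrow> real) \<Rightarrow> real" and L :: real
  assumes add: "\<And>f g. continuous_on {-L..L} f \<Longrightarrow> continuous_on {-L..L} g \<Longrightarrow> T (\<lambda>x. f x + g x) = T f + T g"
    and scale: "\<And>c f. continuous_on {-L..L} f \<Longrightarrow> T (\<lambda>x. c * f x) = c * T f"
    and bound: "\<And>f e. continuous_on {-L..L} f \<Longrightarrow> (\<And>x. x \<in> {-L..L} \<Longrightarrow> \<bar>f x\<bar> \<le> e) \<Longrightarrow> \<bar>T f\<bar> \<le> C * e"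
    and monomial: "\<And>n. T (\<lambda>x. x ^ n) = 0"
    and f: "continuous_on {-L..L} f"
  shows "T f = 0"
proof -
  have poly: "T (\<lambda>x. \<Sum>i\<le>n. a i * x ^ i) = 0" for a :: "nat \<Rightarrow> real" and n
  proof (induction n)
    case 0
    thus ?case using scale[of "\<lambda>x. x ^ 0" "a 0"] monomial[of 0] by simp
  next
    case (Suc n)
    have "T (\<lambda>x. a (Suc n) * x ^ Suc n) = 0"
      using scale[of "\<lambda>x. x ^ Suc n" "a (Suc n)"] monomial[of "Suc n"] by (simp add: continuous_intros)
    thus ?case
      using Suc add[of "\<lambda>x. \<Sum>i\<le>n. a i * x ^ i" "\<lambda>x. a (Suc n) * x ^ Suc n"]
      by (simp add: continuous_intros)
  qed
  have "\<bar>T f\<bar> \<le> e * (\<bar>C\<bar> + 1)" if e: "e > 0" for e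
  proof -
    obtain g where g: "real_polynomial_function g" "\<And>x. x \<in> {-L..L} \<Longrightarrow> \<bar>f x - g x\<bar> < e"
      using Stone_Weierstrass_real_polynomial_function[OF compact_Icc f e] by blast
    have gc: "continuous_on {-L..L} g"
      using continuous_real_polymonial_function[OF g(1)] by (simp add: continuous_at_imp_continuous_on)
    obtain a n where "g = (\<lambda>x. \<Sum>i\<le>n. a i * x ^ i)"
      using g(1) real_polynomial_function_iff_sum by blast
    hence g0: "T g = 0" using poly by simp
    have "T f = T (\<lambda>x. f x - g x)"
      using add[of "\<lambda>x. f x - g x" g] f gc g0 by (simp add: continuous_intros)
    also have "\<bar>\<dots>\<bar> \<le> C * e"
      using g(2) by (intro bound continuous_intros f gc) (auto intro: less_imp_le)
    also have "\<dots> \<le> (\<bar>C\<bar> + 1) * e" using e by (intro mult_right_mono) auto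
    finally show ?thesis by (simp add: mult.commute)
  qed
  hence "\<bar>T f\<bar> / (\<bar>C\<bar> + 1) \<le> 0 + e" if "e > 0" for e
    using that by (simp add: divide_le_eq algebra_simps)
  hence "\<bar>T f\<bar> / (\<bar>C\<bar> + 1) \<le> 0" by (rule field_le_epsilon)
  moreover have "\<bar>C\<bar> + 1 > 0" by simp
  ultimately show ?thesis by (simp add: divide_le_0_iff)
qed

text \<open>For \<open>Q\<close> = H \<xi> and p = \<xi> \<bullet> s this integrates the density
  over the planes with normal \<xi> through the points r s, where 0 \<le> r \<le> L. On x^n it
  yields the divisor n + 1 that cancels the degree-dependent weight in
  \<open>kern_moment\<close>.\<close>

definition ray_integral :: "real \<Rightarrow> (real \<Rightarrow> real) \<Rightarrow> real \<Rightarrow> real" where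
  "ray_integral L Q p = integral {0..L} (\<lambda>l. Q (l * p))"

lemma ray_integral_arg_continuous:
  fixes Q :: "real \<Rightarrow> real"
  assumes "continuous_on {-L..L} Q" "p \<in> {-1..1}"
  shows "continuous_on {0..L} (\<lambda>l. Q (l * p))"
proof (rule continuous_on_compose2[OF assms(1)])
  show "(\<lambda>l. l * p) ` {0..L} \<subseteq> {-L..L}"
  proof
    fix y assume "y \<in> (\<lambda>l. l * p) ` {0..L}"
    then obtain l where "y = l * p" "l \<in> {0..L}" by blast
    moreover from this have "\<bar>l * p\<bar> \<le> L * 1" unfolding abs_mult using assms(2) by (intro mult_mono) auto
    ultimately show "y \<in> {-L..L}" by auto
  qed
qed (intro continuous_intros)

lemma ray_integral_continuous:
  assumes "continuous_on {-L..L} Q"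
  shows "continuous_on {-1..1} (ray_integral L Q)"
  unfolding ray_integral_def
proof (rule continuous_on_real_integral_param, rule continuous_on_compose2[OF assms])
  show "(\<lambda>z. snd z * fst z) ` ({- 1..1} \<times> {0..L}) \<subseteq> {- L..L}"
  proof
    fix y assume "y \<in> (\<lambda>z. snd z * fst z) ` ({- 1..1} \<times> {0..L})"
    then obtain l p where "y = l * p" "l \<in> {0..L}" "p \<in> {-1..1}" by auto
    moreover from this have "\<bar>l * p\<bar> \<le> L * 1" unfolding abs_mult by (intro mult_mono) auto
    ultimately show "y \<in> {-L..L}" by auto
  qed
qed (intro continuous_intros)

lemma ray_integral_add:
  assumes "continuous_on {-L..L} f" "continuous_on {-L..L} g" "p \<in> {-1..1}"
  shows "ray_integral L (\<lambda>x. f x + g x) p = ray_integral L f p + ray_integral L g p"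
  unfolding ray_integral_def by (intro integral_add integrable_continuous_real ray_integral_arg_continuous assms)

lemma ray_integral_scale: "ray_integral L (\<lambda>x. c * f x) p = c * ray_integral L f p"
  unfolding ray_integral_def by simp

lemma ray_integral_bound:
  assumes "L \<ge> 0" "continuous_on {-L..L} f" "p \<in> {-1..1}" "\<And>x. x \<in> {-L..L} \<Longrightarrow> \<bar>f x\<bar> \<le> e"
  shows "\<bar>ray_integral L f p\<bar> \<le> L * e"
proof -
  have "norm (integral {0..L} (\<lambda>l. f (l * p))) \<le> e * (L - 0)"
  proof (intro integral_bound ray_integral_arg_continuous assms)
    fix l assume l: "l \<in> {0..L}"
    hence "\<bar>l * p\<bar> \<le> L * 1" unfolding abs_mult using assms(3) by (intro mult_mono) auto
    thus "norm (f (l * p)) \<le> e" using assms(4)[of "l * p"] by (auto simp: abs_le_iff)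
  qed
  thus ?thesis by (simp add: ray_integral_def mult.commute)
qed

lemma ray_integral_monomial:
  assumes "L \<ge> 0"
  shows "ray_integral L (\<lambda>x. x ^ n) p = L ^ (n + 1) / (n + 1) * p ^ n"
proof -
  have d: "((\<lambda>l. l ^ (n + 1) / (n + 1) * p ^ n) has_real_derivative (l * p) ^ n) (at l)" for l
    using DERIV_cmult_right[OF DERIV_cdivide[OF DERIV_pow[of "Suc n" l], of "n + 1"], of "p ^ n"]
    by (simp add: power_mult_distrib)
  have "ray_integral L (\<lambda>x. x ^ n) p = L ^ (n + 1) / (n + 1) * p ^ n - 0 ^ (n + 1) / (n + 1) * p ^ n"
    unfolding ray_integral_def using assms
    by (intro integral_deriv_eq d)
  thus ?thesis by simp
qed

context sphere_point
begin

section \<open>Linearity and bounds for cap integrals\<close>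

lemma continuous_on_comp_t:
  assumes "continuous_on {-1..1} (f :: real \<Rightarrow> real)" "continuous_on (S :: 'z::metric_space set) g" "continuous_on S h"
  shows "continuous_on S (\<lambda>u. f (t (g u) (h u)))"
proof (rule continuous_on_compose2[OF assms(1)])
  show "(\<lambda>u. t (g u) (h u)) ` S \<subseteq> {- 1..1}" using abs_t_le by (force simp: abs_le_iff)
qed (intro continuous_intros assms)

lemma cap_inner_continuous:
  assumes "continuous_on {-1..1} f" "continuous_on UNIV w"
  shows "continuous_on S (\<lambda>\<phi>. integral {0..a} (\<lambda>\<nu>. w \<nu> * f (t \<nu> \<phi>) * sin \<nu>))"
  by (rule continuous_on_real_integral_param)
    (auto intro!: continuous_intros continuous_on_comp_t[OF assms(1)] continuous_on_compose2[OF assms(2)])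

lemma cap_add:
  assumes "continuous_on {-1..1} f" "continuous_on {-1..1} g" "continuous_on UNIV w"
  shows "cap a (\<lambda>\<nu> p. w \<nu> * (f p + g p)) = cap a (\<lambda>\<nu> p. w \<nu> * f p) + cap a (\<lambda>\<nu> p. w \<nu> * g p)"
proof -
  have "integral {0..a} (\<lambda>\<nu>. w \<nu> * (f (t \<nu> \<phi>) + g (t \<nu> \<phi>)) * sin \<nu>) =
     integral {0..a} (\<lambda>\<nu>. w \<nu> * f (t \<nu> \<phi>) * sin \<nu>) + integral {0..a} (\<lambda>\<nu>. w \<nu> * g (t \<nu> \<phi>) * sin \<nu>)" for \<phi>
    by (subst integral_add[symmetric])
      (auto simp: algebra_simps intro!: integrable_continuous_real continuous_intros continuous_on_comp_t assms
        continuous_on_subset[OF assms(3)])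
  thus ?thesis unfolding cap_def
    by (simp only:) (intro integral_add integrable_continuous_real cap_inner_continuous assms)
qed

lemma cap_scale: "cap a (\<lambda>\<nu> p. w \<nu> * (c * f p)) = c * cap a (\<lambda>\<nu> p. w \<nu> * f p)"
  unfolding cap_def by (simp add: mult.assoc mult.left_commute[of _ c])

lemma cap_bound:
  assumes "continuous_on {-1..1} f" "continuous_on UNIV w" "a \<ge> 0"
    "\<And>p. p \<in> {-1..1} \<Longrightarrow> \<bar>f p\<bar> \<le> e" "\<And>\<nu>. \<bar>w \<nu>\<bar> \<le> B" "B \<ge> 0"
  shows "\<bar>cap a (\<lambda>\<nu> p. w \<nu> * f p)\<bar> \<le> (2 * pi * a * B) * e"
proof -
  have "\<bar>w \<nu> * f (t \<nu> \<phi>) * sin \<nu>\<bar> \<le> B * e * 1" for \<nu> \<phi>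
  proof -
    have "\<bar>f (t \<nu> \<phi>)\<bar> \<le> e" using abs_t_le[of \<nu> \<phi>] by (intro assms) (auto simp: abs_le_iff)
    thus ?thesis unfolding abs_mult
      using assms(5)[of \<nu>] by (intro mult_mono) (auto intro: order_trans[OF abs_ge_zero])
  qed
  hence "\<bar>integral {0..a} (\<lambda>\<nu>. w \<nu> * f (t \<nu> \<phi>) * sin \<nu>)\<bar> \<le> B * e * (a - 0)" for \<phi>
    unfolding real_norm_def[symmetric]
    by (intro integral_bound assms continuous_intros continuous_on_comp_t continuous_on_subset[OF assms(2)]) auto
  hence "\<bar>cap a (\<lambda>\<nu> p. w \<nu> * f p)\<bar> \<le> B * e * a * (2 * pi - 0)"
    unfolding cap_def real_norm_def[symmetric]
    by (intro integral_bound cap_inner_continuous assms) auto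
  thus ?thesis by (simp add: algebra_simps)
qed

lemma cap_monomial:
  assumes "continuous_on UNIV w"
  shows "cap a (\<lambda>\<nu> p. w \<nu> * p ^ n) = integral {0..a} (\<lambda>\<nu>. w \<nu> * moment n \<nu> * sin \<nu>)"
  by (subst cap_swap) (auto intro!: continuous_intros continuous_on_compose2[OF assms] simp: moment_def)

text \<open>The derivative-free identity for one normal. Both sides are linear in \<open>Q\<close>
  and bounded by its maximum on [-L, L], so monomials suffice; there it is a multiple of
  \<open>kern_moment\<close>.\<close>

lemma kernel_identity:
  assumes a: "0 < a" "a < pi" and L: "L > 0" and Q: "continuous_on {-L..L} Q"
  shows "integral {0..2*pi} (\<lambda>\<phi>. kern a \<phi> * ray_integral L Q (t a \<phi>)) =
     cap a (\<lambda>\<nu> p. cos \<nu> * ray_integral L Q p) + L * cap a (\<lambda>\<nu> p. (cos \<nu> - cos a) * Q (L * p))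
     - 2 * pi * (max 0 (z - cos a) * ray_integral L Q 1 + max 0 (- z - cos a) * ray_integral L Q (- 1))"
proof -
  define K where "K = (\<lambda>Q. integral {0..2*pi} (\<lambda>\<phi>. kern a \<phi> * ray_integral L Q (t a \<phi>)))"
  define C1 where "C1 = (\<lambda>Q. cap a (\<lambda>\<nu> p. cos \<nu> * ray_integral L Q p))"
  define C2 where "C2 = (\<lambda>Q. L * cap a (\<lambda>\<nu> p. (cos \<nu> - cos a) * Q (L * p)))"
  define P where "P = (\<lambda>Q. 2 * pi * (max 0 (z - cos a) * ray_integral L Q 1 + max 0 (- z - cos a) * ray_integral L Q (- 1)))"
  define T where "T = (\<lambda>Q. K Q - C1 Q - C2 Q + P Q)"
  note ct = continuous_on_comp_t[OF ray_integral_continuous]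
  have tm: "t a \<phi> \<in> {-1..1}" for \<phi> using abs_t_le[of a \<phi>] by (auto simp: abs_le_iff)
  have QL: "continuous_on {-1..1} (\<lambda>p. f (L * p))" if "continuous_on {-L..L} f" for f :: "real \<Rightarrow> real"
  proof (rule continuous_on_compose2[OF that])
    have "\<bar>L * p\<bar> \<le> L * 1" if "\<bar>p\<bar> \<le> 1" for p unfolding abs_mult using that L by (intro mult_mono) auto
    thus "(\<lambda>p. L * p) ` {-1..1} \<subseteq> {-L..L}" by (force simp: abs_le_iff)
  qed (intro continuous_intros)
  have cw: "continuous_on UNIV (\<lambda>\<nu>::real. cos \<nu> - cos a)" "continuous_on UNIV (\<lambda>\<nu>::real. cos \<nu>)"
    by (intro continuous_intros)+
  have cap_cong: "cap a (\<lambda>\<nu> p. w \<nu> * f p) = cap a (\<lambda>\<nu> p. w \<nu> * g p)"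
    if "\<And>p. p \<in> {-1..1} \<Longrightarrow> f p = g p" for w and f g :: "real \<Rightarrow> real"
  proof -
    have "f (t \<nu> \<phi>) = g (t \<nu> \<phi>)" for \<nu> \<phi> using abs_t_le[of \<nu> \<phi>] that by (auto simp: abs_le_iff)
    thus ?thesis by (simp add: cap_def)
  qed
  have kint: "(\<lambda>\<phi>. kern a \<phi> * ray_integral L f (t a \<phi>)) integrable_on {0..2*pi}" if "continuous_on {-L..L} f" for f
    by (intro kern_mult_integrable a ct that continuous_intros)
  have "T Q = 0"
  proof (rule weierstrass_functional_eq_0[where L = L and f = Q and T = T and
        C = "integral {0..2*pi} (kern a) * L + 2 * pi * a * L + L * (2 * pi * a * 2)
          + 2 * pi * (max 0 (z - cos a) + max 0 (- z - cos a)) * L"])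
    fix f g :: "real \<Rightarrow> real" assume fg: "continuous_on {-L..L} f" "continuous_on {-L..L} g"
    have "K (\<lambda>x. f x + g x) = K f + K g"
      unfolding K_def ray_integral_add[OF fg tm] distrib_left by (intro integral_add kint fg)
    moreover have "C1 (\<lambda>x. f x + g x) = C1 f + C1 g"
      unfolding C1_def by (subst cap_add[symmetric], (intro ray_integral_continuous fg cw)+) (intro cap_cong ray_integral_add fg)
    moreover have "C2 (\<lambda>x. f x + g x) = C2 f + C2 g"
      unfolding C2_def by (subst cap_add) (auto intro!: QL fg cw simp: distrib_left)
    moreover have "P (\<lambda>x. f x + g x) = P f + P g"
      unfolding P_def using ray_integral_add[OF fg, of 1] ray_integral_add[OF fg, of "-1"] by (simp add: algebra_simps)
    ultimately show "T (\<lambda>x. f x + g x) = T f + T g" by (simp add: T_def)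
  next
    fix c and f :: "real \<Rightarrow> real" assume "continuous_on {-L..L} f"
    have "K (\<lambda>x. c * f x) = c * K f"
      unfolding K_def ray_integral_scale mult.left_commute[of _ c] by simp
    moreover have "C1 (\<lambda>x. c * f x) = c * C1 f" by (simp only: C1_def ray_integral_scale cap_scale)
    moreover have "C2 (\<lambda>x. c * f x) = c * C2 f" unfolding C2_def cap_scale by (rule mult.left_commute)
    moreover have "P (\<lambda>x. c * f x) = c * P f" by (simp add: P_def ray_integral_scale algebra_simps)
    ultimately show "T (\<lambda>x. c * f x) = c * T f" by (simp add: T_def algebra_simps)
  next
    fix e and f :: "real \<Rightarrow> real" assume f: "continuous_on {-L..L} f" and e: "\<And>x. x \<in> {-L..L} \<Longrightarrow> \<bar>f x\<bar> \<le> e"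
    have ab: "\<bar>ray_integral L f p\<bar> \<le> L * e" if "p \<in> {-1..1}" for p
      using L f that e by (intro ray_integral_bound) auto
    have "\<bar>K f\<bar> \<le> integral {0..2*pi} (\<lambda>\<phi>. kern a \<phi> * (L * e))"
      unfolding K_def real_norm_def[symmetric]
      by (rule integral_norm_bound_integral[OF kint[OF f]])
        (use ab[OF tm] kern_nonneg in \<open>auto simp: abs_mult intro!: mult_left_mono kern_mult_integrable a\<close>)
    hence 1: "\<bar>K f\<bar> \<le> integral {0..2*pi} (kern a) * L * e" by simp
    have 2: "\<bar>C1 f\<bar> \<le> (2 * pi * a * 1) * (L * e)"
      unfolding C1_def using a by (intro cap_bound ray_integral_continuous f cw ab) auto
    have Le: "\<bar>f (L * p)\<bar> \<le> e" if "p \<in> {-1..1}" for p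
    proof -
      have "\<bar>L * p\<bar> \<le> L * 1" unfolding abs_mult using that L by (intro mult_mono) auto
      thus ?thesis using e by (auto simp: abs_le_iff)
    qed
    have "\<bar>cos \<nu> - cos a\<bar> \<le> 2" for \<nu>
      using abs_cos_le_one[of \<nu>] abs_cos_le_one[of a] by linarith
    hence "\<bar>cap a (\<lambda>\<nu> p. (cos \<nu> - cos a) * f (L * p))\<bar> \<le> (2 * pi * a * 2) * e"
      using a by (intro cap_bound QL f cw Le) auto
    hence 3: "\<bar>C2 f\<bar> \<le> L * ((2 * pi * a * 2) * e)"
      unfolding C2_def abs_mult using L by (intro mult_mono) auto
    have "\<bar>max 0 (z - cos a) * ray_integral L f 1 + max 0 (- z - cos a) * ray_integral L f (- 1)\<bar> \<le>
        max 0 (z - cos a) * (L * e) + max 0 (- z - cos a) * (L * e)"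
      by (rule order_trans[OF abs_triangle_ineq], unfold abs_mult, intro add_mono mult_mono ab) auto
    hence 4: "\<bar>P f\<bar> \<le> 2 * pi * (max 0 (z - cos a) * (L * e) + max 0 (- z - cos a) * (L * e))"
      unfolding P_def abs_mult by (intro mult_mono) auto
    have "\<bar>T f\<bar> \<le> \<bar>K f\<bar> + \<bar>C1 f\<bar> + \<bar>C2 f\<bar> + \<bar>P f\<bar>" unfolding T_def by linarith
    also have "\<dots> \<le> (integral {0..2*pi} (kern a) * L * e) + (2 * pi * a * 1) * (L * e) + L * ((2 * pi * a * 2) * e) +
       2 * pi * (max 0 (z - cos a) * (L * e) + max 0 (- z - cos a) * (L * e))"
      by (intro add_mono 1 2 3 4)
    also have "\<dots> = (integral {0..2*pi} (kern a) * L + 2 * pi * a * L + L * (2 * pi * a * 2)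
          + 2 * pi * (max 0 (z - cos a) + max 0 (- z - cos a)) * L) * e"
      by (simp only: distrib_left distrib_right mult.assoc mult_1_right mult_1_left)
    finally show "\<bar>T f\<bar> \<le> (integral {0..2*pi} (kern a) * L + 2 * pi * a * L + L * (2 * pi * a * 2)
          + 2 * pi * (max 0 (z - cos a) + max 0 (- z - cos a)) * L) * e" .
  next
    fix n :: nat
    \<comment> \<open>The coefficient of p^n in the ray integral of x^n. Since (n + 1) k = L * L^n,
      the weight n + 1 is absorbed into the value of the monomial at L p, which no longer depends on
      n explicitly.\<close>
    define k where "k = L ^ (n + 1) / (n + 1)"
    have k: "(n + 1) * k = L ^ (n + 1)" by (simp add: k_def)
    have av: "ray_integral L (\<lambda>x. x ^ n) p = k * p ^ n" for p
      using ray_integral_monomial[of L n p] L by (simp add: k_def)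
    have "K (\<lambda>x. x ^ n) = k * integral {0..2*pi} (\<lambda>\<phi>. kern a \<phi> * t a \<phi> ^ n)"
      unfolding K_def av by (subst integral_mult_right[symmetric]) (simp add: algebra_simps)
    moreover have "C1 (\<lambda>x. x ^ n) = k * integral {0..a} (\<lambda>\<nu>. cos \<nu> * moment n \<nu> * sin \<nu>)"
      unfolding C1_def av cap_scale by (simp add: cap_monomial cw)
    moreover have "C2 (\<lambda>x. x ^ n) = ((n + 1) * k) * integral {0..a} (\<lambda>\<nu>. (cos \<nu> - cos a) * moment n \<nu> * sin \<nu>)"
      unfolding C2_def power_mult_distrib cap_scale k by (simp add: cap_monomial cw)
    moreover have "P (\<lambda>x. x ^ n) = 2 * pi * k * (max 0 (z - cos a) + (- 1) ^ n * max 0 (- z - cos a))"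
      unfolding P_def av by (simp add: algebra_simps)
    moreover have "integral {0..a} (\<lambda>\<nu>. sin \<nu> * (((real n + 1) * (cos \<nu> - cos a) + cos \<nu>) * moment n \<nu>)) =
       (n + 1) * integral {0..a} (\<lambda>\<nu>. (cos \<nu> - cos a) * moment n \<nu> * sin \<nu>) + integral {0..a} (\<lambda>\<nu>. cos \<nu> * moment n \<nu> * sin \<nu>)"
      unfolding integral_mult_right[symmetric]
      by (subst integral_add[symmetric]) (auto intro!: integrable_continuous_real continuous_intros integral_cong simp: algebra_simps)
    ultimately show "T (\<lambda>x. x ^ n) = 0"
      unfolding T_def kern_moment[OF a] by (simp add: algebra_simps)
  qed (fact Q)
  thus ?thesis by (simp add: T_def K_def C1_def C2_def P_def)
qed

end

section \<open>Rotation invariance of the spherical integral\<close>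

text \<open>Handedness is left open. This permits the negated frame, which realizes the antipodal
  map, and covers both orientations of (u, v) in the theorem.\<close>

locale frame =
  fixes c u v :: vec3
  assumes unit: "norm c = 1" "norm u = 1" "norm v = 1"
    and orth: "c \<bullet> u = 0" "c \<bullet> v = 0" "u \<bullet> v = 0"
begin

lemma dots: "c \<bullet> c = 1" "u \<bullet> u = 1" "v \<bullet> v = 1" "u \<bullet> c = 0" "v \<bullet> c = 0" "v \<bullet> u = 0"
  using unit orth by (auto simp: norm_eq_1 inner_commute)

lemma expand: "(s \<bullet> c) *\<^sub>R c + (s \<bullet> u) *\<^sub>R u + (s \<bullet> v) *\<^sub>R v = s"
proof -
  have ne: "c \<noteq> u" "c \<noteq> v" "u \<noteq> v" using dots orth by auto
  have po: "pairwise orthogonal {c, u, v}"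
    using orth by (auto simp: pairwise_def orthogonal_def inner_commute)
  have "0 \<notin> {c, u, v}" using unit by auto
  hence "independent {c, u, v}" using pairwise_orthogonal_independent[OF po] by blast
  moreover have "card {c, u, v} = 3" using ne by simp
  ultimately have "span {c, u, v} = UNIV"
    using card_ge_dim_independent[of "{c, u, v}" UNIV] by auto
  hence "s \<in> span {c, u, v}" by simp
  hence "(\<Sum>b\<in>{c, u, v}. (s \<bullet> b) *\<^sub>R b) = s"
    using unit by (intro orthonormal_basis_expand po) auto
  thus ?thesis using ne by (simp add: add.assoc)
qed

lemma parseval: "(s \<bullet> c)\<^sup>2 + (s \<bullet> u)\<^sup>2 + (s \<bullet> v)\<^sup>2 = s \<bullet> s"
proof -
  have "s \<bullet> s = s \<bullet> ((s \<bullet> c) *\<^sub>R c + (s \<bullet> u) *\<^sub>R u + (s \<bullet> v) *\<^sub>R v)" by (simp only: expand)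
  thus ?thesis by (simp add: inner_add_right power2_eq_square)
qed

lemma sphere_point: "norm \<xi> = 1 \<Longrightarrow> sphere_point (\<xi> \<bullet> c) (\<xi> \<bullet> u) (\<xi> \<bullet> v)"
  using parseval[of \<xi>] by (simp add: sphere_point_def norm_eq_1)

lemma inner_sph: "\<xi> \<bullet> sph c u v \<phi> \<nu> = sphere_point.t (\<xi> \<bullet> c) (\<xi> \<bullet> u) (\<xi> \<bullet> v) \<nu> \<phi>" if "norm \<xi> = 1"
  by (simp add: sphere_point.t_def[OF sphere_point[OF that]] sphere_point.q_def[OF sphere_point[OF that]]
      sph_def inner_add_right inner_diff_right algebra_simps)

lemma c_sph: "c \<bullet> sph c u v \<phi> \<nu> = cos \<nu>"
  using orth by (simp add: sph_def inner_add_right dots)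

lemma norm_sph: "norm (sph c u v \<phi> \<nu>) = 1"
proof -
  have "sph c u v \<phi> \<nu> \<bullet> sph c u v \<phi> \<nu> = (cos \<nu>)\<^sup>2 + ((sin \<nu> * cos \<phi>)\<^sup>2 + (sin \<nu> * sin \<phi>)\<^sup>2)"
    by (simp add: sph_def inner_add_right inner_add_left dots orth power2_eq_square algebra_simps)
  also have "\<dots> = 1"
    unfolding power_mult_distrib distrib_left[symmetric] by simp
  finally show ?thesis by (simp add: norm_eq_1)
qed

lemma sph_continuous [continuous_intros]:
  "continuous_on (S :: 'z::metric_space set) f \<Longrightarrow> continuous_on S g \<Longrightarrow> continuous_on S (\<lambda>z. sph c u v (f z) (g z))"
  unfolding sph_def by (intro continuous_intros)

lemma cap_integral_eq_cap:
  assumes "norm \<xi> = 1"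
  shows "cap_integral c u v a (\<lambda>s. G (c \<bullet> s) (\<xi> \<bullet> s)) = sphere_point.cap (\<xi> \<bullet> c) (\<xi> \<bullet> u) (\<xi> \<bullet> v) a (\<lambda>\<nu>. G (cos \<nu>))"
  unfolding cap_integral_def sphere_point.cap_def[OF sphere_point[OF assms]] c_sph inner_sph[OF assms] ..

lemma continuous_on_comp_sph:
  assumes "continuous_on (sphere 0 1) F" "continuous_on (S :: 'z::metric_space set) f" "continuous_on S g"
  shows "continuous_on S (\<lambda>z. F (sph c u v (f z) (g z)))"
  by (rule continuous_on_compose2[OF assms(1)]) (auto intro!: continuous_intros assms simp: norm_sph)

lemma cap_integral_inner_continuous:
  assumes "continuous_on (sphere 0 1) (F :: vec3 \<Rightarrow> real)"
  shows "continuous_on S (\<lambda>\<phi>. integral {0..a} (\<lambda>\<nu>. F (sph c u v \<phi> \<nu>) * sin \<nu>))"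
  by (rule continuous_on_real_integral_param)
    (intro continuous_intros continuous_on_comp_sph[OF assms])

lemma cap_integral_add:
  assumes "continuous_on (sphere 0 1) F" "continuous_on (sphere 0 1) G"
  shows "cap_integral c u v a (\<lambda>s. F s + G s) = cap_integral c u v a F + cap_integral c u v a G"
proof -
  have "integral {0..a} (\<lambda>\<nu>. (F (sph c u v \<phi> \<nu>) + G (sph c u v \<phi> \<nu>)) * sin \<nu>) =
     integral {0..a} (\<lambda>\<nu>. F (sph c u v \<phi> \<nu>) * sin \<nu>) + integral {0..a} (\<lambda>\<nu>. G (sph c u v \<phi> \<nu>) * sin \<nu>)" for \<phi>
    unfolding distrib_right
    by (intro integral_add integrable_continuous_real continuous_intros continuous_on_comp_sph[OF assms(1)]
        continuous_on_comp_sph[OF assms(2)])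
  thus ?thesis unfolding cap_integral_def
    by (simp only:) (intro integral_add integrable_continuous_real cap_integral_inner_continuous assms)
qed

lemma cap_integral_cmult: "cap_integral c u v a (\<lambda>s. k * F s) = k * cap_integral c u v a F"
  unfolding cap_integral_def by (simp add: mult.assoc)

lemma cap_integral_bound:
  assumes "continuous_on (sphere 0 1) F" "a \<ge> 0" "\<And>s. norm s = 1 \<Longrightarrow> \<bar>F s\<bar> \<le> e"
  shows "\<bar>cap_integral c u v a F\<bar> \<le> (2 * pi * a) * e"
proof -
  have "\<bar>F (sph c u v \<phi> \<nu>) * sin \<nu>\<bar> \<le> e * 1" for \<nu> \<phi>
    unfolding abs_mult using assms(3)[OF norm_sph, of \<phi> \<nu>]
    by (intro mult_mono) (auto intro: order_trans[OF abs_ge_zero])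
  hence "\<bar>integral {0..a} (\<lambda>\<nu>. F (sph c u v \<phi> \<nu>) * sin \<nu>)\<bar> \<le> e * (a - 0)" for \<phi>
    unfolding real_norm_def[symmetric]
    by (intro integral_bound assms continuous_intros continuous_on_comp_sph[OF assms(1)]) auto
  hence "\<bar>cap_integral c u v a F\<bar> \<le> e * a * (2 * pi - 0)"
    unfolding cap_integral_def real_norm_def[symmetric]
    by (intro integral_bound cap_integral_inner_continuous assms) auto
  thus ?thesis by (simp add: algebra_simps)
qed

lemma cap_integral_moment:
  assumes "norm \<xi> = 1"
  shows "cap_integral c u v pi (\<lambda>s. (\<xi> \<bullet> s) ^ n) = (if even n then 4 * pi / (n + 1) else 0)"
proof -
  interpret sphere_point "\<xi> \<bullet> c" "\<xi> \<bullet> u" "\<xi> \<bullet> v" by (rule sphere_point[OF assms])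
  show ?thesis
    using cap_integral_eq_cap[OF assms, of pi "\<lambda>_ p. p ^ n"] cap_monomial[of "\<lambda>_. 1" pi n] sphere_moment[of n]
    by simp
qed

end

text \<open>
  The moments of \<open>\<xi> \<bullet> s\<close> do not depend on the frame, so neither do the integrals of \<open>exp (y \<bullet> s)\<close>,
  whose span is an algebra to which Stone-Weierstrass applies.
\<close>

inductive_set exp_sums :: "(vec3 \<Rightarrow> real) set" where
  zero: "(\<lambda>_. 0) \<in> exp_sums"
| step: "g \<in> exp_sums \<Longrightarrow> (\<lambda>s. g s + a * exp (y \<bullet> s)) \<in> exp_sums"

lemma exp_sums_add: "g \<in> exp_sums \<Longrightarrow> f \<in> exp_sums \<Longrightarrow> (\<lambda>s. f s + g s) \<in> exp_sums"
proof (induction rule: exp_sums.induct)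
  case (step g a y)
  thus ?case using exp_sums.step[of "\<lambda>s. f s + g s" a y] by (simp add: add.assoc)
qed simp

lemma exp_sums_mult_exp: "g \<in> exp_sums \<Longrightarrow> (\<lambda>s. g s * (a * exp (y \<bullet> s))) \<in> exp_sums"
proof (induction rule: exp_sums.induct)
  case (step g b x)
  thus ?case using exp_sums.step[of "\<lambda>s. g s * (a * exp (y \<bullet> s))" "b * a" "x + y"]
    by (simp add: algebra_simps inner_add_left exp_add)
qed (simp add: exp_sums.zero)

lemma exp_sums_mult: "g \<in> exp_sums \<Longrightarrow> f \<in> exp_sums \<Longrightarrow> (\<lambda>s. f s * g s) \<in> exp_sums"
proof (induction rule: exp_sums.induct)
  case (step g a y)
  show ?case
    using exp_sums_add[OF exp_sums_mult_exp[OF step.prems, of a y] step.IH[OF step.prems]]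
    by (simp add: distrib_left)
qed (simp add: exp_sums.zero)

lemma exp_sums_exp: "(\<lambda>s. a * exp (y \<bullet> s)) \<in> exp_sums"
  using exp_sums.step[OF exp_sums.zero, of a y] by simp

lemma exp_sums_continuous: "g \<in> exp_sums \<Longrightarrow> continuous_on S g"
  by (induction rule: exp_sums.induct) (auto intro!: continuous_intros)

text \<open>\<open>sphere_integral\<close> is tied to fixed axes, while the computation needs the
  pole at the centre of the disc. The difference \<open>J\<close> of the two integrals is bounded by
  the maximum norm, so it suffices that it vanishes on a dense algebra. Exponentials fit because
  each depends on a single inner product with s, and products of them are again
  exponentials.\<close>

theorem cap_integral_pi_frame_independent:
  assumes fr: "frame c u v" "frame c' u' v'" and F: "continuous_on (sphere 0 1) F"
  shows "cap_integral c u v pi F = cap_integral c' u' v' pi F"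
proof -
  interpret A: frame c u v by fact
  interpret B: frame c' u' v' by fact
  define J where "J = (\<lambda>F. cap_integral c u v pi F - cap_integral c' u' v' pi F)"
  have J_add: "J (\<lambda>s. F s + G s) = J F + J G" if "continuous_on (sphere 0 1) F" "continuous_on (sphere 0 1) G" for F G
    by (simp add: J_def A.cap_integral_add B.cap_integral_add that)
  have J_cmult: "J (\<lambda>s. k * F s) = k * J F" for k F
    by (simp add: J_def A.cap_integral_cmult B.cap_integral_cmult algebra_simps)
  have J_bound: "\<bar>J F\<bar> \<le> (4 * pi * pi) * e" if "continuous_on (sphere 0 1) F" "\<And>s. norm s = 1 \<Longrightarrow> \<bar>F s\<bar> \<le> e" for F e
    using A.cap_integral_bound[OF that(1), of pi e] B.cap_integral_bound[OF that(1), of pi e] that(2)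
    by (simp add: J_def abs_le_iff)
  \<comment> \<open>As a function of the single variable \<xi> \<bullet> s, the exponential is
    within reach of the one-dimensional criterion, whose monomials are the known moments. For y = 0
    any unit vector serves as \<xi>.\<close>
  have J_exp: "J (\<lambda>s. exp (y \<bullet> s)) = 0" for y
  proof -
    obtain \<xi> where \<xi>: "norm \<xi> = 1" "y = norm y *\<^sub>R \<xi>"
    proof (cases "y = 0")
      case True
      thus ?thesis using that[of c] A.unit(1) by simp
    next
      case False
      thus ?thesis using that[of "sgn y"] by (simp add: norm_sgn sgn_div_norm)
    qed
    have rng: "\<xi> \<bullet> s \<in> {-1..1}" if "norm s = 1" for s
      using Cauchy_Schwarz_ineq2[of \<xi> s] that \<xi>(1) by (auto simp: abs_le_iff)
    have cont: "continuous_on (sphere 0 1) (\<lambda>s. f (\<xi> \<bullet> s))" if "continuous_on {-1..1} f" for f :: "real \<Rightarrow> real"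
      by (rule continuous_on_compose2[OF that]) (use rng in \<open>auto intro!: continuous_intros\<close>)
    have "J (\<lambda>s. exp (norm y * (\<xi> \<bullet> s))) = 0"
    proof (rule weierstrass_functional_eq_0[where L = 1 and T = "\<lambda>f. J (\<lambda>s. f (\<xi> \<bullet> s))" and C = "4 * pi * pi"])
      show "J (\<lambda>s. (\<xi> \<bullet> s) ^ n) = 0" for n
        by (simp add: J_def A.cap_integral_moment B.cap_integral_moment \<xi>(1))
    qed (use rng in \<open>auto intro!: J_add J_cmult J_bound cont continuous_intros\<close>)
    thus ?thesis by (subst \<xi>(2)) (simp only: inner_scaleR_left)
  qed
  have J_sums: "J g = 0" if "g \<in> exp_sums" for g
    using that
  proof (induction rule: exp_sums.induct)
    case zero
    show ?case using J_cmult[of 0 "\<lambda>_. 0"] by simp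
  next
    case (step g a y)
    have "J (\<lambda>s. g s + a * exp (y \<bullet> s)) = J g + J (\<lambda>s. a * exp (y \<bullet> s))"
      by (intro J_add exp_sums_continuous[OF step.hyps] continuous_intros)
    thus ?case by (simp add: step.IH J_cmult J_exp)
  qed
  have "\<bar>J F\<bar> \<le> 0 + e" if e: "e > 0" for e
  proof -
    have "\<exists>g. g \<in> exp_sums \<and> (\<forall>x\<in>sphere 0 1. \<bar>F x - g x\<bar> < e / (4 * pi * pi))"
    proof (rule Stone_Weierstrass_HOL[where P = "\<lambda>g. g \<in> exp_sums"])
      show "(\<lambda>_. k) \<in> exp_sums" for k :: real using exp_sums_exp[of k 0] by simp
      \<comment> \<open>Distinct unit vectors satisfy x \<bullet> y < 1 = x \<bullet> x, so exp (x
        \<bullet> s) takes different values at x and y.\<close>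
      fix x y :: vec3 assume "x \<in> sphere 0 1 \<and> y \<in> sphere 0 1 \<and> x \<noteq> y"
      hence "x \<bullet> x = 1" "y \<bullet> y = 1" "x \<noteq> y" by (auto simp: norm_eq_1)
      moreover have "(x - y) \<bullet> (x - y) = x \<bullet> x - 2 * (x \<bullet> y) + y \<bullet> y"
        by (simp add: inner_diff_left inner_diff_right inner_commute)
      moreover have "(x - y) \<bullet> (x - y) \<noteq> 0" using \<open>x \<noteq> y\<close> by simp
      ultimately have "x \<bullet> x \<noteq> x \<bullet> y" by linarith
      thus "\<exists>f. f \<in> exp_sums \<and> f x \<noteq> f y" using exp_sums_exp[of 1 x] by (intro exI[of _ "\<lambda>s. 1 * exp (x \<bullet> s)"]) auto
    qed (use e F in \<open>auto intro: exp_sums_add exp_sums_mult exp_sums_continuous\<close>)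
    then obtain g where g: "g \<in> exp_sums" "\<And>x. norm x = 1 \<Longrightarrow> \<bar>F x - g x\<bar> < e / (4 * pi * pi)" by auto
    have gc: "continuous_on S g" for S by (rule exp_sums_continuous[OF g(1)])
    have "J F = J (\<lambda>s. F s - g s) + J g" using J_add[of "\<lambda>s. F s - g s" g] F gc by (simp add: continuous_intros)
    hence "J F = J (\<lambda>s. F s - g s)" using J_sums[OF g(1)] by simp
    moreover have "\<bar>J (\<lambda>s. F s - g s)\<bar> \<le> (4 * pi * pi) * (e / (4 * pi * pi))"
      by (rule J_bound) (use g(2) F gc in \<open>auto intro!: continuous_intros less_imp_le\<close>)
    ultimately show ?thesis by simp
  qed
  hence "\<bar>J F\<bar> \<le> 0" by (rule field_le_epsilon)
  thus ?thesis by (simp add: J_def)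
qed

lemma frame_axes: "frame (axis 3 1) (axis 1 1) (axis 2 1)"
  by unfold_locales (auto simp: inner_axis_axis)

lemma (in frame) frame_uminus: "frame (- c) (- u) (- v)"
  using unit orth by unfold_locales auto

lemma (in frame) sphere_integral_eq:
  "continuous_on (sphere 0 1) F \<Longrightarrow> sphere_integral F = cap_integral c u v pi F"
  unfolding sphere_integral_def by (intro cap_integral_pi_frame_independent frame_axes) unfold_locales

text \<open>Negating all three axes sends the point with given angles to its antipode, so this is
  frame independence for the negated axes.\<close>

lemma sphere_integral_uminus:
  assumes "continuous_on (sphere 0 1) F"
  shows "sphere_integral (\<lambda>s. F (- s)) = sphere_integral F"
proof -
  interpret frame "axis 3 1" "axis 1 1" "axis 2 1 :: vec3" by (rule frame_axes)
  have "sph (- axis 3 1) (- axis 1 1) (- axis 2 1) \<phi> \<nu> = - sph (axis 3 1) (axis 1 1) (axis 2 1) \<phi> \<nu>" for \<phi> \<nu>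
    by (simp add: sph_def algebra_simps)
  thus ?thesis
    using frame.sphere_integral_eq[OF frame_uminus assms] by (simp add: sphere_integral_def cap_integral_def)
qed

section \<open>Exchanging integrals over the sphere\<close>

lemma bounded_borel_integral:
  fixes f :: "real \<Rightarrow> real"
  assumes f: "f \<in> borel_measurable borel" and bd: "\<And>y. y \<in> {c..d} \<Longrightarrow> \<bar>f y\<bar> \<le> B"
  shows "f integrable_on {c..d}"
    and "integral {c..d} f = (LINT y|lborel. indicator {c..d} y * f y)"
    and "c \<le> d \<Longrightarrow> \<bar>integral {c..d} f\<bar> \<le> B * (d - c)"
proof -
  have "set_integrable lborel {c..d} f"
    unfolding set_integrable_def
    by (rule integrableI_bounded_set[where A = "{c..d}" and B = B])
      (use f bd in \<open>auto simp: indicator_def emeasure_lborel_Icc_eq intro!: borel_measurable_if\<close>)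
  note * = set_borel_integral_eq_integral[OF this]
  show 1: "f integrable_on {c..d}" by (rule *(1))
  show "integral {c..d} f = (LINT y|lborel. indicator {c..d} y * f y)"
    using *(2) by (simp add: set_lebesgue_integral_def)
  show "\<bar>integral {c..d} f\<bar> \<le> B * (d - c)" if "c \<le> d"
    using integral_norm_bound_integral[OF 1 integrable_const_ivl[of B]] bd that by (simp add: mult.commute)
qed

lemma borel_measurable_param_integral:
  fixes f :: "'a \<Rightarrow> real \<Rightarrow> real"
  assumes f: "(\<lambda>p. f (fst p) (snd p)) \<in> borel_measurable (M \<Otimes>\<^sub>M borel)"
    and bd: "\<And>x y. x \<in> space M \<Longrightarrow> y \<in> {c..d} \<Longrightarrow> \<bar>f x y\<bar> \<le> B"
  shows "(\<lambda>x. integral {c..d} (f x)) \<in> borel_measurable M"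
proof -
  have "(\<lambda>x. LINT y|lborel. indicator {c..d} y * f x y) \<in> borel_measurable M"
  proof (rule lborel.borel_measurable_lebesgue_integral)
    have "(\<lambda>p. indicator {c..d} (snd p) * f (fst p) (snd p)) \<in> borel_measurable (M \<Otimes>\<^sub>M lborel)"
      by (intro borel_measurable_times) (use f in \<open>auto cong: measurable_cong_sets\<close>)
    thus "(\<lambda>(x, y). indicator {c..d} y * f x y) \<in> borel_measurable (M \<Otimes>\<^sub>M lborel)"
      by (simp add: case_prod_unfold)
  qed
  moreover have "integral {c..d} (f x) = (LINT y|lborel. indicator {c..d} y * f x y)" if "x \<in> space M" for x
    using measurable_compose[OF measurable_Pair1'[OF that] f] bd[OF that]
    by (intro bounded_borel_integral(2)[where B = B]) auto
  ultimately show ?thesis by (simp cong: measurable_cong)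
qed

text \<open>Fubini beyond continuous integrands is needed for the squared cosine of the flag
  density, which is bounded and Borel but discontinuous at normals parallel to that of the
  flag.\<close>

lemma bounded_borel_integral_swap:
  fixes f :: "real \<Rightarrow> real \<Rightarrow> real"
  assumes f: "(\<lambda>p. f (fst p) (snd p)) \<in> borel_measurable borel"
    and bd: "\<And>x y. \<bar>f x y\<bar> \<le> B"
  shows "integral {a..b} (\<lambda>x. integral {c..d} (\<lambda>y. f x y)) = integral {c..d} (\<lambda>y. integral {a..b} (\<lambda>x. f x y))"
proof -
  have f1: "(\<lambda>p. f (fst p) (snd p)) \<in> borel_measurable (borel \<Otimes>\<^sub>M borel)"
    using f by (simp add: borel_prod)
  have f2: "(\<lambda>p. f (snd p) (fst p)) \<in> borel_measurable (borel \<Otimes>\<^sub>M borel)"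
    using measurable_compose[OF measurable_pair_swap' f1] by (simp add: case_prod_unfold)
  have m1: "(\<lambda>y. f x y) \<in> borel_measurable borel" for x
    using measurable_compose[OF measurable_Pair1' f1, of x] by simp
  have m2: "(\<lambda>x. f x y) \<in> borel_measurable borel" for y
    using measurable_compose[OF measurable_Pair1' f2, of y] by simp
  have i1: "integral {c..d} (\<lambda>y. f x y) = (LINT y|lborel. indicator {c..d} y * f x y)" for x
    by (rule bounded_borel_integral(2)[OF m1 bd])
  have i2: "integral {a..b} (\<lambda>x. f x y) = (LINT x|lborel. indicator {a..b} x * f x y)" for y
    by (rule bounded_borel_integral(2)[OF m2 bd])
  \<comment> \<open>The maximum with 0 covers the empty interval, where the integral is 0 but
    \<open>B * (d - c)\<close> may be negative.\<close>
  have b1: "\<bar>integral {c..d} (\<lambda>y. f x y)\<bar> \<le> max 0 (B * (d - c))" for x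
    using bounded_borel_integral(3)[OF m1 bd, of c d] by (cases "c \<le> d") (auto intro: max.coboundedI2)
  have b2: "\<bar>integral {a..b} (\<lambda>x. f x y)\<bar> \<le> max 0 (B * (b - a))" for y
    using bounded_borel_integral(3)[OF m2 bd, of a b] by (cases "a \<le> b") (auto intro: max.coboundedI2)
  have e1: "integral {a..b} (\<lambda>x. integral {c..d} (\<lambda>y. f x y)) =
     (LINT x|lborel. indicator {a..b} x * (LINT y|lborel. indicator {c..d} y * f x y))"
    by (subst bounded_borel_integral(2)[OF borel_measurable_param_integral[OF f1 bd] b1]) (simp add: i1)
  have e2: "integral {c..d} (\<lambda>y. integral {a..b} (\<lambda>x. f x y)) =
     (LINT y|lborel. indicator {c..d} y * (LINT x|lborel. indicator {a..b} x * f x y))"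
    by (subst bounded_borel_integral(2)[OF borel_measurable_param_integral[OF f2 bd] b2]) (simp add: i2)
  define g where "g = (\<lambda>x y. indicator {a..b} x * (indicator {c..d} y * f x y) :: real)"
  have "integrable (lborel \<Otimes>\<^sub>M lborel) (case_prod g)"
  proof (rule integrableI_bounded_set[where A = "{a..b} \<times> {c..d}" and B = "\<bar>B\<bar>"])
    show "emeasure (lborel \<Otimes>\<^sub>M lborel) ({a..b} \<times> {c..d}) < \<infinity>"
      by (subst lborel.emeasure_pair_measure_Times) (auto simp: ennreal_mult_less_top emeasure_lborel_Icc_eq)
    show "case_prod g \<in> borel_measurable (lborel \<Otimes>\<^sub>M lborel)"
    proof -
      have "(\<lambda>p. indicator {a..b} (fst p) * (indicator {c..d} (snd p) * f (fst p) (snd p))) \<in> borel_measurable (lborel \<Otimes>\<^sub>M lborel)"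
        by (intro borel_measurable_times) (use f1 in \<open>auto cong: measurable_cong_sets\<close>)
      thus ?thesis by (simp add: g_def case_prod_unfold)
    qed
    have "norm (case_prod g p) \<le> \<bar>B\<bar>" for p
      using bd[of "fst p" "snd p"] by (auto simp: g_def case_prod_unfold indicator_def)
    thus "AE p in lborel \<Otimes>\<^sub>M lborel. p \<in> {a..b} \<times> {c..d} \<longrightarrow> norm (case_prod g p) \<le> \<bar>B\<bar>" by simp
    have "case_prod g p = 0" if "p \<notin> {a..b} \<times> {c..d}" for p
      using that by (cases p) (auto simp: g_def indicator_def)
    thus "AE p in lborel \<Otimes>\<^sub>M lborel. p \<notin> {a..b} \<times> {c..d} \<longrightarrow> case_prod g p = 0" by simp
  qed auto
  hence "(LINT y|lborel. LINT x|lborel. g x y) = (LINT x|lborel. LINT y|lborel. g x y)"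
    by (rule lborel_pair.Fubini_integral)
  moreover have "(LINT y|lborel. g x y) = indicator {a..b} x * (LINT y|lborel. indicator {c..d} y * f x y)" for x
    by (simp add: g_def)
  moreover have "(LINT x|lborel. g x y) = indicator {c..d} y * (LINT x|lborel. indicator {a..b} x * f x y)" for y
  proof -
    have "g x y = indicator {c..d} y * (indicator {a..b} x * f x y)" for x by (simp add: g_def)
    thus ?thesis by simp
  qed
  ultimately show ?thesis unfolding e1 e2 by simp
qed

abbreviation sph0 :: "real \<Rightarrow> real \<Rightarrow> vec3" where
  "sph0 \<equiv> sph (axis 3 1) (axis 1 1) (axis 2 1)"

interpretation axes: frame "axis 3 1 :: vec3" "axis 1 1" "axis 2 1"
  by (rule frame_axes)

text \<open>Measurability is asked in the angular coordinates: the sphere integral sees F only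
  there, and the densities of interest are controlled only for unit normals.\<close>

lemma sphere_integral_swap_global:
  fixes F :: "vec3 \<Rightarrow> real \<Rightarrow> real"
  assumes meas: "(\<lambda>p. F (sph0 (fst p) (fst (snd p))) (snd (snd p))) \<in> borel_measurable borel"
    and bd: "\<And>\<xi> x. norm \<xi> = 1 \<Longrightarrow> \<bar>F \<xi> x\<bar> \<le> B"
  shows "sphere_integral (\<lambda>\<xi>. integral {a..b} (F \<xi>)) = integral {a..b} (\<lambda>x. sphere_integral (\<lambda>\<xi>. F \<xi> x))"
proof -
  define f where "f = (\<lambda>\<phi> \<nu> x. F (sph0 \<phi> \<nu>) x * sin \<nu>)"
  have "(\<lambda>p. F (sph0 (fst p) (fst (snd p))) (snd (snd p)) * sin (fst (snd p))) \<in> borel_measurable borel"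
    by (intro borel_measurable_times meas borel_measurable_continuous_onI continuous_intros)
  hence fm: "(\<lambda>p. f (fst p) (fst (snd p)) (snd (snd p))) \<in> borel_measurable borel"
    by (simp add: f_def)
  have fb: "\<bar>f \<phi> \<nu> x\<bar> \<le> B" for \<phi> \<nu> x
  proof -
    have "\<bar>f \<phi> \<nu> x\<bar> \<le> B * 1"
      unfolding f_def abs_mult using bd[OF axes.norm_sph, of \<phi> \<nu> x]
      by (intro mult_mono) (auto intro: order_trans[OF abs_ge_zero])
    thus ?thesis by simp
  qed
  have comp: "(\<lambda>z. f (f1 z) (f2 z) (f3 z)) \<in> borel_measurable borel"
    if "continuous_on UNIV f1" "continuous_on UNIV f2" "continuous_on UNIV f3"
    for f1 f2 f3 :: "'z::euclidean_space \<Rightarrow> real"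
    using measurable_compose[OF borel_measurable_continuous_onI fm, of "\<lambda>z. (f1 z, f2 z, f3 z)"] that
    by (simp add: continuous_on_Pair)
  have gm: "(\<lambda>p. integral {0..pi} (\<lambda>\<nu>. f (fst p) \<nu> (snd p))) \<in> borel_measurable borel"
    by (rule borel_measurable_param_integral[where B = B])
      (auto simp: fb borel_prod intro!: comp continuous_intros)
  have gb: "\<bar>integral {0..pi} (\<lambda>\<nu>. f \<phi> \<nu> x)\<bar> \<le> B * (pi - 0)" for \<phi> x
    by (rule bounded_borel_integral(3)) (auto simp: fb intro!: comp continuous_intros)
  have "sphere_integral (\<lambda>\<xi>. integral {a..b} (F \<xi>)) =
     integral {0..2*pi} (\<lambda>\<phi>. integral {0..pi} (\<lambda>\<nu>. integral {a..b} (\<lambda>x. f \<phi> \<nu> x)))"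
    by (simp add: sphere_integral_def cap_integral_def f_def)
  also have "\<dots> = integral {0..2*pi} (\<lambda>\<phi>. integral {a..b} (\<lambda>x. integral {0..pi} (\<lambda>\<nu>. f \<phi> \<nu> x)))"
    by (subst bounded_borel_integral_swap[where B = B]) (auto simp: fb intro!: comp continuous_intros)
  also have "\<dots> = integral {a..b} (\<lambda>x. integral {0..2*pi} (\<lambda>\<phi>. integral {0..pi} (\<lambda>\<nu>. f \<phi> \<nu> x)))"
    by (rule bounded_borel_integral_swap[OF gm gb])
  also have "\<dots> = integral {a..b} (\<lambda>x. sphere_integral (\<lambda>\<xi>. F \<xi> x))"
    by (simp add: sphere_integral_def cap_integral_def f_def)
  finally show ?thesis .
qed

text \<open>A density on all planes need not be bounded; cutting it off outside {a..b} leaves both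
  sides unchanged and makes the bound global.\<close>

lemma sphere_integral_swap:
  fixes F :: "vec3 \<Rightarrow> real \<Rightarrow> real"
  assumes meas: "(\<lambda>p. F (sph0 (fst p) (fst (snd p))) (snd (snd p))) \<in> borel_measurable borel"
    and bd: "\<And>\<xi> x. norm \<xi> = 1 \<Longrightarrow> x \<in> {a..b} \<Longrightarrow> \<bar>F \<xi> x\<bar> \<le> B"
  shows "sphere_integral (\<lambda>\<xi>. integral {a..b} (F \<xi>)) = integral {a..b} (\<lambda>x. sphere_integral (\<lambda>\<xi>. F \<xi> x))"
proof -
  define G where "G = (\<lambda>\<xi> x. indicator {a..b} x * F \<xi> x)"
  have "(\<lambda>p. G (sph0 (fst p) (fst (snd p))) (snd (snd p))) \<in> borel_measurable borel"
  proof -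
    have s: "(\<lambda>p::real\<times>real\<times>real. snd (snd p)) \<in> borel_measurable borel"
      by (intro borel_measurable_continuous_onI continuous_intros)
    show ?thesis unfolding G_def
      by (intro borel_measurable_times meas measurable_compose[OF s]) auto
  qed
  moreover have "\<bar>G \<xi> x\<bar> \<le> \<bar>B\<bar>" if "norm \<xi> = 1" for \<xi> x
    using bd[OF that, of x] by (auto simp: G_def indicator_def)
  ultimately have "sphere_integral (\<lambda>\<xi>. integral {a..b} (G \<xi>)) = integral {a..b} (\<lambda>x. sphere_integral (\<lambda>\<xi>. G \<xi> x))"
    by (rule sphere_integral_swap_global)
  moreover have "integral {a..b} (G \<xi>) = integral {a..b} (F \<xi>)" for \<xi>
    by (rule integral_cong) (simp add: G_def)
  moreover have "integral {a..b} (\<lambda>x. sphere_integral (\<lambda>\<xi>. G \<xi> x)) = integral {a..b} (\<lambda>x. sphere_integral (\<lambda>\<xi>. F \<xi> x))"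
    by (rule integral_cong) (simp add: G_def)
  ultimately show ?thesis by simp
qed

lemma sphere_integral_swap_continuous:
  fixes F :: "vec3 \<Rightarrow> real \<Rightarrow> real"
  assumes F: "continuous_on (sphere 0 1 \<times> UNIV) (\<lambda>p. F (fst p) (snd p))"
  shows "sphere_integral (\<lambda>\<xi>. integral {a..b} (F \<xi>)) = integral {a..b} (\<lambda>x. sphere_integral (\<lambda>\<xi>. F \<xi> x))"
proof -
  have "compact ((\<lambda>p. F (fst p) (snd p)) ` (sphere 0 1 \<times> {a..b}))"
    by (intro compact_continuous_image continuous_on_subset[OF F] compact_Times) auto
  hence "bounded ((\<lambda>p. F (fst p) (snd p)) ` (sphere 0 1 \<times> {a..b}))"
    by (rule compact_imp_bounded)
  then obtain B where B: "\<And>\<xi> x. norm \<xi> = 1 \<Longrightarrow> x \<in> {a..b} \<Longrightarrow> \<bar>F \<xi> x\<bar> \<le> B"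
    unfolding bounded_iff by force
  show ?thesis
  proof (rule sphere_integral_swap)
    show "(\<lambda>p. F (sph0 (fst p) (fst (snd p))) (snd (snd p))) \<in> borel_measurable borel"
    proof (rule borel_measurable_continuous_onI)
      have "continuous_on UNIV (\<lambda>p::real\<times>real\<times>real. (sph0 (fst p) (fst (snd p)), snd (snd p)))"
        by (intro continuous_intros axes.sph_continuous)
      from continuous_on_compose2[OF F this]
      show "continuous_on UNIV (\<lambda>p. F (sph0 (fst p) (fst (snd p))) (snd (snd p)))"
        by (simp add: image_subset_iff axes.norm_sph)
    qed
    show "\<bar>F \<xi> x\<bar> \<le> B" if "norm \<xi> = 1" "x \<in> {a..b}" for \<xi> x
      by (rule B[OF that])
  qed
qed

lemma sphere_integral_cong:
  "(\<And>\<xi>. norm \<xi> = 1 \<Longrightarrow> F \<xi> = G \<xi>) \<Longrightarrow> sphere_integral F = sphere_integral G"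
  by (simp add: sphere_integral_def cap_integral_def axes.norm_sph)

section \<open>The integrated identity\<close>

lemma cos_flag_angle_measurable:
  fixes f g e :: "'z::euclidean_space \<Rightarrow> vec3"
  assumes "continuous_on UNIV f" "continuous_on UNIV g" "continuous_on UNIV e"
  shows "(\<lambda>z. cos_flag_angle (f z) (g z) (e z)) \<in> borel_measurable borel"
  unfolding cos_flag_angle_def Let_def
  by (intro borel_measurable_divide borel_measurable_continuous_onI continuous_intros assms)

lemma abs_cos_flag_angle_le: "norm g = 1 \<Longrightarrow> \<bar>cos_flag_angle w g \<xi>\<bar> \<le> 1"
  unfolding cos_flag_angle_def Let_def
  using Cauchy_Schwarz_ineq2[of g "\<xi> - (\<xi> \<bullet> w) *\<^sub>R w"]
  by (cases "norm (\<xi> - (\<xi> \<bullet> w) *\<^sub>R w) = 0") (auto simp: divide_le_eq)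

lemma cos_flag_angle_square:
  assumes "norm w = 1" "w \<bullet> g = 0" "norm \<xi> = 1"
  shows "(cos_flag_angle w g \<xi>)\<^sup>2 = (g \<bullet> \<xi>)\<^sup>2 / (1 - (\<xi> \<bullet> w)\<^sup>2)"
proof -
  have "(norm (\<xi> - (\<xi> \<bullet> w) *\<^sub>R w))\<^sup>2 = 1 - (\<xi> \<bullet> w)\<^sup>2"
    unfolding power2_norm_eq_inner using assms by (simp add: inner_diff_left inner_diff_right norm_eq_1 inner_commute power2_eq_square)
  moreover have "g \<bullet> (\<xi> - (\<xi> \<bullet> w) *\<^sub>R w) = g \<bullet> \<xi>"
    using assms by (simp add: inner_diff_right inner_commute)
  ultimately show ?thesis by (simp add: cos_flag_angle_def Let_def power_divide)
qed

context frame
begin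

definition equator where "equator \<phi> = cos \<phi> *\<^sub>R u + sin \<phi> *\<^sub>R v"
text \<open>The cross product with c, and not the derivative of \<open>equator\<close>, fixes the
  direction independently of the handedness of (c, u, v).\<close>

definition tangent where "tangent \<phi> = cross3 c (equator \<phi>)"
definition sph' where "sph' \<phi> \<nu> = cos \<nu> *\<^sub>R equator \<phi> - sin \<nu> *\<^sub>R c"

lemma sph_eq: "sph c u v \<phi> \<nu> = cos \<nu> *\<^sub>R c + sin \<nu> *\<^sub>R equator \<phi>"
  by (simp add: sph_def equator_def)

lemma equator_dots: "equator \<phi> \<bullet> equator \<phi> = 1" "c \<bullet> equator \<phi> = 0"
proof -
  have "equator \<phi> \<bullet> equator \<phi> = (cos \<phi>)\<^sup>2 + (sin \<phi>)\<^sup>2"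
    by (simp add: equator_def inner_add_left inner_add_right dots orth power2_eq_square algebra_simps)
  thus "equator \<phi> \<bullet> equator \<phi> = 1" by simp
  show "c \<bullet> equator \<phi> = 0" by (simp add: equator_def inner_add_right orth)
qed

lemma norm_tangent: "norm (tangent \<phi>) = 1"
proof -
  have "(norm (tangent \<phi>))\<^sup>2 + (c \<bullet> equator \<phi>)\<^sup>2 = (norm c * norm (equator \<phi>))\<^sup>2"
    unfolding tangent_def by (rule norm_cross_dot)
  thus ?thesis using equator_dots[of \<phi>] unit by (simp add: norm_eq_1)
qed

lemma tangent_dots: "c \<bullet> tangent \<phi> = 0" "equator \<phi> \<bullet> tangent \<phi> = 0" "sph c u v \<phi> \<nu> \<bullet> tangent \<phi> = 0"
proof -
  show 1: "c \<bullet> tangent \<phi> = 0" "equator \<phi> \<bullet> tangent \<phi> = 0" by (simp_all add: tangent_def dot_cross_self)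
  show "sph c u v \<phi> \<nu> \<bullet> tangent \<phi> = 0"
    by (simp add: sph_eq inner_add_left 1)
qed

lemma tangent_dir_sph:
  assumes "0 < a" "a < pi"
  shows "tangent_dir c (sph c u v \<phi> a) = tangent \<phi>"
proof -
  have "cross3 c (sph c u v \<phi> a) = sin a *\<^sub>R tangent \<phi>"
    by (simp add: sph_eq tangent_def cross_add_right cross_mult_right)
  thus ?thesis using sin_gt_zero[OF assms] by (simp add: tangent_dir_def norm_tangent)
qed

text \<open>The axis x_2 of the tangent flag is the unit meridian direction away from c. So the
  rotation in \<open>rho_Phi\<close> moves the normal along the meridian, and the translation in
  \<open>rho_y\<close> moves the location tangentially to it.\<close>

lemma cross_tangent_sph: "cross3 (tangent \<phi>) (sph c u v \<phi> \<nu>) = sph' \<phi> \<nu>"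
proof -
  have "cross3 (cross3 c e) w = (c \<bullet> w) *\<^sub>R e - (e \<bullet> w) *\<^sub>R c" for e w :: vec3
    using Lagrange[of w c e] by (simp add: cross_skew[of "cross3 c e" w] inner_commute)
  thus ?thesis
    using equator_dots[of \<phi>] dots
    by (simp add: tangent_def sph'_def sph_eq inner_add_right inner_commute[of "equator \<phi>" c])
qed

lemma equator_continuous [continuous_intros]:
    "continuous_on (S :: 'z::metric_space set) f \<Longrightarrow> continuous_on S (\<lambda>z. equator (f z))"
  unfolding equator_def by (intro continuous_intros)

lemma tangent_continuous [continuous_intros]:
    "continuous_on (S :: 'z::metric_space set) f \<Longrightarrow> continuous_on S (\<lambda>z. tangent (f z))"
  unfolding tangent_def by (intro continuous_intros continuous_on_cross)

lemma sph'_continuous [continuous_intros]: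
  "continuous_on (S :: 'z::metric_space set) f \<Longrightarrow> continuous_on S g \<Longrightarrow> continuous_on S (\<lambda>z. sph' (f z) (g z))"
  unfolding sph'_def by (intro continuous_intros)

text \<open>The number q' is \<xi> \<bullet> \<open>tangent \<phi>\<close> up to a sign given by the
  handedness of the frame. Only squares enter, and Parseval in the frame of c, equator and tangent
  identifies them without deciding the sign.\<close>

lemma kern_eq_cos_flag_angle:
  assumes "norm \<xi> = 1"
  shows "sphere_point.kern (\<xi> \<bullet> c) (\<xi> \<bullet> u) (\<xi> \<bullet> v) a \<phi> = (sin a)\<^sup>2 * (cos_flag_angle (sph c u v \<phi> a) (tangent \<phi>) \<xi>)\<^sup>2"
proof -
  interpret P: sphere_point "\<xi> \<bullet> c" "\<xi> \<bullet> u" "\<xi> \<bullet> v" by (rule sphere_point[OF assms])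
  interpret T: frame c "equator \<phi>" "tangent \<phi>"
    by unfold_locales (use equator_dots tangent_dots norm_tangent unit in \<open>auto simp: norm_eq_1\<close>)
  have "P.q \<phi> = \<xi> \<bullet> equator \<phi>" by (simp add: P.q_def equator_def inner_add_right algebra_simps)
  hence "(P.q' \<phi>)\<^sup>2 = (\<xi> \<bullet> tangent \<phi>)\<^sup>2"
    using T.parseval[of \<xi>] P.q_q'[of \<phi>] assms by (simp add: norm_eq_1)
  thus ?thesis
    using cos_flag_angle_square[OF norm_sph tangent_dots(3) assms, of \<phi> a] inner_sph[OF assms, of \<phi> a]
    by (simp add: P.kern_def power_mult_distrib inner_commute)
qed

end

section \<open>Integration over all normals\<close>

lemma plane_uminus: "plane (- \<xi>) p = plane \<xi> (- p)"
  by (auto simp: plane_def)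

locale plane_density = frame c u v for c u v :: vec3 +
  fixes h :: "vec3 set \<Rightarrow> real"
  assumes h_cont: "continuous_on (sphere 0 1 \<times> UNIV) (\<lambda>z. h (plane (fst z) (snd z)))"
begin

definition H where "H \<xi> p = h (plane \<xi> p)"

lemma H_uminus: "H (- \<xi>) p = H \<xi> (- p)"
  by (simp add: H_def plane_uminus)

lemma H_continuous:
  assumes "continuous_on (S :: 'z::metric_space set) f" "continuous_on S g" "\<And>z. z \<in> S \<Longrightarrow> norm (f z) = 1"
  shows "continuous_on S (\<lambda>z. H (f z) (g z))"
  unfolding H_def
  using continuous_on_compose2[OF h_cont continuous_on_Pair[OF assms(1,2)]] assms(3)
  by (simp add: image_subset_iff)

lemma ray_H_continuous:
  assumes "continuous_on (S :: 'z::metric_space set) f" "continuous_on S g" "\<And>z. z \<in> S \<Longrightarrow> norm (f z) = 1"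
  shows "continuous_on S (\<lambda>z. ray_integral L (H (f z)) (g z))"
  unfolding ray_integral_def
  by (rule continuous_on_real_integral_param)
    (auto intro!: H_continuous continuous_intros continuous_on_compose2[OF assms(1)] continuous_on_compose2[OF assms(2)] assms(3))

lemma bundle_mass_eq: "sphere_integral (\<lambda>\<xi>. H \<xi> (\<xi> \<bullet> x)) = 2 * bundle_mass h x"
  by (simp add: bundle_mass_def hx_def H_def)

lemma flag_density_eq: "sphere_integral (\<lambda>\<xi>. (cos_flag_angle w g \<xi>)\<^sup>2 * H \<xi> (\<xi> \<bullet> x)) = 2 * flag_density h x w g"
  by (simp add: flag_density_def hx_def H_def)

text \<open>Applied with K the ray integral of H and with K the value of H at L p, where p = \<xi>
  \<bullet> s. The continuity in \<xi> is what later permits splitting the sphere integral into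
  summands.\<close>

lemma cap_swap_sphere:
  assumes K: "continuous_on (sphere 0 1 \<times> UNIV) (\<lambda>p. K (fst p) (snd p))" and w: "continuous_on UNIV w"
  shows "continuous_on (sphere 0 1) (\<lambda>\<xi>. cap_integral c u v a (\<lambda>s. w (c \<bullet> s) * K \<xi> (\<xi> \<bullet> s)))"
    and "sphere_integral (\<lambda>\<xi>. cap_integral c u v a (\<lambda>s. w (c \<bullet> s) * K \<xi> (\<xi> \<bullet> s))) =
       cap_integral c u v a (\<lambda>s. w (c \<bullet> s) * sphere_integral (\<lambda>\<xi>. K \<xi> (\<xi> \<bullet> s)))"
proof -
  define F where "F = (\<lambda>\<xi> \<phi> \<nu>. w (cos \<nu>) * K \<xi> (\<xi> \<bullet> sph c u v \<phi> \<nu>) * sin \<nu>)"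
  have KK: "continuous_on S (\<lambda>z. K (f z) (g z))"
    if "continuous_on S f" "continuous_on S g" "\<And>z. z \<in> S \<Longrightarrow> norm (f z) = 1" for f g and S :: "'z::metric_space set"
    using continuous_on_compose2[OF K continuous_on_Pair[OF that(1,2)]] that(3) by (simp add: image_subset_iff)
  have Fc: "continuous_on S (\<lambda>z. F (f z) (g1 z) (g2 z))"
    if "continuous_on S f" "continuous_on S g1" "continuous_on S g2" "\<And>z. z \<in> S \<Longrightarrow> norm (f z) = 1"
    for f g1 g2 and S :: "'z::metric_space set"
    unfolding F_def
    by (intro continuous_intros KK continuous_on_compose2[OF w] that sph_continuous) auto
  have F1: "continuous_on S (\<lambda>z. integral {0..a} (F (f z) (g z)))"
    if "continuous_on S f" "continuous_on S g" "\<And>z. z \<in> S \<Longrightarrow> norm (f z) = 1" for f g and S :: "'z::metric_space set"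
    by (rule continuous_on_real_integral_param)
      (auto intro!: Fc continuous_intros continuous_on_compose2[OF that(1)] continuous_on_compose2[OF that(2)] that(3))
  have eq: "cap_integral c u v a (\<lambda>s. w (c \<bullet> s) * K \<xi> (\<xi> \<bullet> s)) = integral {0..2*pi} (\<lambda>\<phi>. integral {0..a} (F \<xi> \<phi>))" for \<xi>
    by (simp add: cap_integral_def F_def c_sph)
  show "continuous_on (sphere 0 1) (\<lambda>\<xi>. cap_integral c u v a (\<lambda>s. w (c \<bullet> s) * K \<xi> (\<xi> \<bullet> s)))"
    unfolding eq by (rule continuous_on_real_integral_param) (auto intro!: F1 continuous_intros)
  have "sphere_integral (\<lambda>\<xi>. cap_integral c u v a (\<lambda>s. w (c \<bullet> s) * K \<xi> (\<xi> \<bullet> s))) =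
     integral {0..2*pi} (\<lambda>\<phi>. sphere_integral (\<lambda>\<xi>. integral {0..a} (F \<xi> \<phi>)))"
    unfolding eq by (rule sphere_integral_swap_continuous) (auto intro!: F1 continuous_intros)
  also have "\<dots> = integral {0..2*pi} (\<lambda>\<phi>. integral {0..a} (\<lambda>\<nu>. sphere_integral (\<lambda>\<xi>. F \<xi> \<phi> \<nu>)))"
    by (subst sphere_integral_swap_continuous) (auto intro!: Fc continuous_intros)
  also have "\<dots> = integral {0..2*pi} (\<lambda>\<phi>. integral {0..a} (\<lambda>\<nu>. (w (cos \<nu>) * sin \<nu>) * sphere_integral (\<lambda>\<xi>. K \<xi> (\<xi> \<bullet> sph c u v \<phi> \<nu>))))"
    unfolding sphere_integral_def axes.cap_integral_cmult[symmetric] F_def by (simp only: mult_ac)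
  also have "\<dots> = cap_integral c u v a (\<lambda>s. w (c \<bullet> s) * sphere_integral (\<lambda>\<xi>. K \<xi> (\<xi> \<bullet> s)))"
    by (simp add: cap_integral_def c_sph mult_ac)
  finally show "sphere_integral (\<lambda>\<xi>. cap_integral c u v a (\<lambda>s. w (c \<bullet> s) * K \<xi> (\<xi> \<bullet> s))) =
       cap_integral c u v a (\<lambda>s. w (c \<bullet> s) * sphere_integral (\<lambda>\<xi>. K \<xi> (\<xi> \<bullet> s)))" .
qed

lemma ray_sphere_swap:
  "sphere_integral (\<lambda>\<xi>. ray_integral L (H \<xi>) (\<xi> \<bullet> s)) = 2 * integral {0..L} (\<lambda>r. bundle_mass h (r *\<^sub>R s))"
proof -
  have "sphere_integral (\<lambda>\<xi>. ray_integral L (H \<xi>) (\<xi> \<bullet> s)) = integral {0..L} (\<lambda>r. sphere_integral (\<lambda>\<xi>. H \<xi> (r * (\<xi> \<bullet> s))))"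
    unfolding ray_integral_def
    by (rule sphere_integral_swap_continuous) (auto intro!: H_continuous continuous_intros)
  also have "\<dots> = integral {0..L} (\<lambda>r. 2 * bundle_mass h (r *\<^sub>R s))"
    by (simp add: bundle_mass_eq[symmetric])
  finally show ?thesis by simp
qed

text \<open>Here an integral over normals becomes an integral over the disc: with the pole moved to
  c by frame independence, the positive part cuts the sphere down to the cap.\<close>

lemma sphere_integral_positive_part:
  assumes a: "0 < a" "a < pi" and f: "continuous_on (sphere 0 1) f"
  shows "sphere_integral (\<lambda>\<xi>. max 0 (\<xi> \<bullet> c - cos a) * f \<xi>) = cap_integral c u v a (\<lambda>s. (c \<bullet> s - cos a) * f s)"
proof -
  have cont: "continuous_on (sphere 0 1) (\<lambda>\<xi>. max 0 (\<xi> \<bullet> c - cos a) * f \<xi>)"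
    by (intro continuous_intros f)
  have "integral {0..pi} (\<lambda>\<nu>. max 0 (cos \<nu> - cos a) * f (sph c u v \<phi> \<nu>) * sin \<nu>) =
     integral {0..a} (\<lambda>\<nu>. (cos \<nu> - cos a) * f (sph c u v \<phi> \<nu>) * sin \<nu>)" (is "integral _ ?g = integral _ ?g'") for \<phi>
  proof -
    have "?g integrable_on {0..pi}"
      by (intro integrable_continuous_real continuous_intros continuous_on_comp_sph[OF f])
    hence "integral {0..pi} ?g = integral {0..a} ?g + integral {a..pi} ?g"
      using a by (intro Henstock_Kurzweil_Integration.integral_combine[symmetric]) auto
    also have "integral {0..a} ?g = integral {0..a} ?g'"
      using a by (intro integral_cong) (auto simp: max_def dest: cos_monotone_0_pi_le[of _ a])
    also have "integral {a..pi} ?g = integral {a..pi} (\<lambda>_. 0)"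
    proof (rule integral_cong)
      fix \<nu> assume "\<nu> \<in> {a..pi}"
      hence "cos \<nu> \<le> cos a" using a by (intro cos_monotone_0_pi_le) auto
      thus "?g \<nu> = 0" by simp
    qed
    finally show ?thesis by simp
  qed
  thus ?thesis
    using sphere_integral_eq[OF cont] by (simp add: cap_integral_def c_sph inner_commute[of _ c])
qed

text \<open>\<open>kernel_identity\<close> integrated over all \<xi>. The kernel term gives 2
  \<rho>, the cap terms give 2 M, and the two positive parts give twice the same integral, so a
  factor 2 cancels throughout.\<close>

theorem integrated_identity:
  assumes a: "0 < a" "a < pi" and L: "L > 0"
  shows "(sin a)\<^sup>2 * integral {0..2*pi} (\<lambda>\<phi>. integral {0..L} (\<lambda>r. flag_density h (r *\<^sub>R sph c u v \<phi> a) (sph c u v \<phi> a) (tangent \<phi>))) =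
     cap_integral c u v a (\<lambda>s. (c \<bullet> s) * integral {0..L} (\<lambda>r. bundle_mass h (r *\<^sub>R s)))
     + L * cap_integral c u v a (\<lambda>s. (c \<bullet> s - cos a) * bundle_mass h (L *\<^sub>R s))
     - 2 * pi * cap_integral c u v a (\<lambda>s. (c \<bullet> s - cos a) * integral {0..L} (H s))"
proof -
  let ?l = "\<lambda>\<phi>. sph c u v \<phi> a"
  define R1 where "R1 = (\<lambda>\<xi>. cap_integral c u v a (\<lambda>s. (c \<bullet> s) * ray_integral L (H \<xi>) (\<xi> \<bullet> s)))"
  define R2 where "R2 = (\<lambda>\<xi>. cap_integral c u v a (\<lambda>s. (c \<bullet> s - cos a) * H \<xi> (L * (\<xi> \<bullet> s))))"
  \<comment> \<open>The second positive part is \<open>R3 (- \<xi>)\<close>, because (-\<xi>, p) and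
    (\<xi>, -p) describe the same plane; both therefore have the same sphere integral.\<close>
  define R3 where "R3 = (\<lambda>\<xi>. max 0 (\<xi> \<bullet> c - cos a) * ray_integral L (H \<xi>) 1)"
  have pointwise: "integral {0..2*pi} (\<lambda>\<phi>. (sin a)\<^sup>2 * (cos_flag_angle (?l \<phi>) (tangent \<phi>) \<xi>)\<^sup>2 * ray_integral L (H \<xi>) (\<xi> \<bullet> ?l \<phi>))
      = R1 \<xi> + L * R2 \<xi> + (- 2 * pi) * (R3 \<xi> + R3 (- \<xi>))" if \<xi>: "norm \<xi> = 1" for \<xi>
  proof -
    interpret P: sphere_point "\<xi> \<bullet> c" "\<xi> \<bullet> u" "\<xi> \<bullet> v" by (rule sphere_point[OF \<xi>])
    have "continuous_on {- L..L} (H \<xi>)" using \<xi> by (intro H_continuous continuous_intros) auto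
    note P.kernel_identity[OF a L this]
    moreover have "ray_integral L (H (- \<xi>)) 1 = ray_integral L (H \<xi>) (- 1)"
      by (simp add: ray_integral_def H_uminus[abs_def])
    ultimately show ?thesis
      unfolding kern_eq_cos_flag_angle[OF \<xi>] R1_def R2_def
        cap_integral_eq_cap[OF \<xi>, of a "\<lambda>m p. m * ray_integral L (H \<xi>) p"]
        cap_integral_eq_cap[OF \<xi>, of a "\<lambda>m p. (m - cos a) * H \<xi> (L * p)"]
        inner_sph[OF \<xi>]
      by (simp add: R3_def)
  qed
  have R1c: "continuous_on (sphere 0 1) R1"
    and R1i: "sphere_integral R1 = 2 * cap_integral c u v a (\<lambda>s. (c \<bullet> s) * integral {0..L} (\<lambda>r. bundle_mass h (r *\<^sub>R s)))"
  proof -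
    have K: "continuous_on (sphere 0 1 \<times> UNIV) (\<lambda>p. ray_integral L (H (fst p)) (snd p))"
      by (rule ray_H_continuous) (auto intro!: continuous_intros)
    note * = cap_swap_sphere[OF K continuous_on_id, of a]
    show "continuous_on (sphere 0 1) R1" unfolding R1_def by (rule *(1))
    show "sphere_integral R1 = 2 * cap_integral c u v a (\<lambda>s. (c \<bullet> s) * integral {0..L} (\<lambda>r. bundle_mass h (r *\<^sub>R s)))"
      unfolding R1_def *(2) ray_sphere_swap mult.left_commute[of _ 2] cap_integral_cmult ..
  qed
  have R2c: "continuous_on (sphere 0 1) R2"
    and R2i: "sphere_integral R2 = 2 * cap_integral c u v a (\<lambda>s. (c \<bullet> s - cos a) * bundle_mass h (L *\<^sub>R s))"
  proof -
    have K: "continuous_on (sphere 0 1 \<times> UNIV) (\<lambda>p. H (fst p) (L * snd p))"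
      by (rule H_continuous) (auto intro!: continuous_intros)
    have w: "continuous_on UNIV (\<lambda>m. m - cos a)" by (intro continuous_intros)
    have e: "sphere_integral (\<lambda>\<xi>. H \<xi> (L * (\<xi> \<bullet> s))) = 2 * bundle_mass h (L *\<^sub>R s)" for s
      by (simp add: bundle_mass_eq[symmetric])
    note * = cap_swap_sphere[OF K w, of a]
    show "continuous_on (sphere 0 1) R2" unfolding R2_def by (rule *(1))
    show "sphere_integral R2 = 2 * cap_integral c u v a (\<lambda>s. (c \<bullet> s - cos a) * bundle_mass h (L *\<^sub>R s))"
      unfolding R2_def *(2) e mult.left_commute[of _ 2] cap_integral_cmult ..
  qed
  have R3c: "continuous_on (sphere 0 1) R3"
    unfolding R3_def by (intro continuous_intros ray_H_continuous) auto
  have R3i: "sphere_integral R3 = cap_integral c u v a (\<lambda>s. (c \<bullet> s - cos a) * integral {0..L} (H s))"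
  proof -
    have "continuous_on (sphere 0 1) (\<lambda>\<xi>. ray_integral L (H \<xi>) 1)"
      by (intro continuous_intros ray_H_continuous) auto
    thus ?thesis unfolding R3_def
      by (subst sphere_integral_positive_part[OF a]) (auto simp: ray_integral_def)
  qed
  have R3m: "continuous_on (sphere 0 1) (\<lambda>\<xi>. R3 (- \<xi>))"
    by (rule continuous_on_compose2[OF R3c]) (auto intro!: continuous_intros)
  have "sphere_integral (\<lambda>\<xi>. integral {0..2*pi} (\<lambda>\<phi>. (sin a)\<^sup>2 * (cos_flag_angle (?l \<phi>) (tangent \<phi>) \<xi>)\<^sup>2 * ray_integral L (H \<xi>) (\<xi> \<bullet> ?l \<phi>)))
     = sphere_integral (\<lambda>\<xi>. R1 \<xi> + L * R2 \<xi> + (- 2 * pi) * (R3 \<xi> + R3 (- \<xi>)))"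
    by (intro sphere_integral_cong pointwise)
  also have "\<dots> = sphere_integral R1 + L * sphere_integral R2 + (- 2 * pi) * (2 * sphere_integral R3)"
  proof -
    have "sphere_integral (\<lambda>\<xi>. R1 \<xi> + L * R2 \<xi> + (- 2 * pi) * (R3 \<xi> + R3 (- \<xi>))) =
       sphere_integral R1 + L * sphere_integral R2 + (- 2 * pi) * (sphere_integral R3 + sphere_integral (\<lambda>\<xi>. R3 (- \<xi>)))"
      unfolding sphere_integral_def axes.cap_integral_cmult[symmetric]
      by (simp only: axes.cap_integral_add[symmetric] axes.cap_integral_cmult[symmetric] R1c R2c R3c R3m continuous_intros)
    thus ?thesis by (simp add: sphere_integral_uminus[OF R3c])
  qed
  also have "sphere_integral (\<lambda>\<xi>. integral {0..2*pi} (\<lambda>\<phi>. (sin a)\<^sup>2 * (cos_flag_angle (?l \<phi>) (tangent \<phi>) \<xi>)\<^sup>2 * ray_integral L (H \<xi>) (\<xi> \<bullet> ?l \<phi>)))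
     = 2 * ((sin a)\<^sup>2 * integral {0..2*pi} (\<lambda>\<phi>. integral {0..L} (\<lambda>r. flag_density h (r *\<^sub>R ?l \<phi>) (?l \<phi>) (tangent \<phi>))))"
  proof -
    have "compact ((\<lambda>p. H (fst p) (snd p)) ` (sphere 0 1 \<times> {-L..L}))"
      by (intro compact_continuous_image H_continuous compact_Times) (auto intro!: continuous_intros)
    hence "bounded ((\<lambda>p. H (fst p) (snd p)) ` (sphere 0 1 \<times> {-L..L}))" by (rule compact_imp_bounded)
    then obtain B where B: "\<And>\<xi> p. norm \<xi> = 1 \<Longrightarrow> p \<in> {-L..L} \<Longrightarrow> \<bar>H \<xi> p\<bar> \<le> B"
      unfolding bounded_iff by force
    have dot: "\<xi> \<bullet> ?l \<phi> \<in> {-1..1}" if "norm \<xi> = 1" for \<xi> \<phi>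
      using Cauchy_Schwarz_ineq2[of \<xi> "?l \<phi>"] that norm_sph[of \<phi> a] by (auto simp: abs_le_iff)
    have k1: "(cos_flag_angle (?l \<phi>) (tangent \<phi>) \<xi>)\<^sup>2 \<le> 1" for \<phi> \<xi>
      using abs_cos_flag_angle_le[OF norm_tangent] by (simp add: abs_square_le_1)
    have s1: "(sin a)\<^sup>2 \<le> 1" by (simp add: abs_square_le_1)
    have inner: "sphere_integral (\<lambda>\<xi>. (cos_flag_angle (?l \<phi>) (tangent \<phi>) \<xi>)\<^sup>2 * ray_integral L (H \<xi>) (\<xi> \<bullet> ?l \<phi>))
        = integral {0..L} (\<lambda>r. 2 * flag_density h (r *\<^sub>R ?l \<phi>) (?l \<phi>) (tangent \<phi>))" for \<phi>
    proof -
      have "sphere_integral (\<lambda>\<xi>. integral {0..L} (\<lambda>r. (cos_flag_angle (?l \<phi>) (tangent \<phi>) \<xi>)\<^sup>2 * H \<xi> (r * (\<xi> \<bullet> ?l \<phi>))))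
        = integral {0..L} (\<lambda>r. sphere_integral (\<lambda>\<xi>. (cos_flag_angle (?l \<phi>) (tangent \<phi>) \<xi>)\<^sup>2 * H \<xi> (r * (\<xi> \<bullet> ?l \<phi>))))"
      proof (rule sphere_integral_swap)
        show "(\<lambda>p. (cos_flag_angle (?l \<phi>) (tangent \<phi>) (sph0 (fst p) (fst (snd p))))\<^sup>2 *
             H (sph0 (fst p) (fst (snd p))) (snd (snd p) * (sph0 (fst p) (fst (snd p)) \<bullet> ?l \<phi>))) \<in> borel_measurable borel"
          by (intro borel_measurable_times borel_measurable_power cos_flag_angle_measurable
              borel_measurable_continuous_onI H_continuous continuous_intros axes.sph_continuous axes.norm_sph)
        fix \<xi> :: vec3 and r assume *: "norm \<xi> = 1" "r \<in> {0..L}"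
        have "\<bar>r * (\<xi> \<bullet> ?l \<phi>)\<bar> \<le> L * 1"
          unfolding abs_mult using * dot[OF *(1), of \<phi>] by (intro mult_mono) auto
        hence "\<bar>H \<xi> (r * (\<xi> \<bullet> ?l \<phi>))\<bar> \<le> B" by (intro B *) (auto simp: abs_le_iff)
        hence "\<bar>(cos_flag_angle (?l \<phi>) (tangent \<phi>) \<xi>)\<^sup>2 * H \<xi> (r * (\<xi> \<bullet> ?l \<phi>))\<bar> \<le> 1 * B"
          unfolding abs_mult using k1[of \<phi> \<xi>] by (intro mult_mono) auto
        thus "\<bar>(cos_flag_angle (?l \<phi>) (tangent \<phi>) \<xi>)\<^sup>2 * H \<xi> (r * (\<xi> \<bullet> ?l \<phi>))\<bar> \<le> B" by simp
      qed
      thus ?thesis by (simp add: ray_integral_def flag_density_eq[symmetric])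
    qed
    have "sphere_integral (\<lambda>\<xi>. integral {0..2*pi} (\<lambda>\<phi>. (sin a)\<^sup>2 * (cos_flag_angle (?l \<phi>) (tangent \<phi>) \<xi>)\<^sup>2 * ray_integral L (H \<xi>) (\<xi> \<bullet> ?l \<phi>)))
      = integral {0..2*pi} (\<lambda>\<phi>. sphere_integral (\<lambda>\<xi>. (sin a)\<^sup>2 * (cos_flag_angle (?l \<phi>) (tangent \<phi>) \<xi>)\<^sup>2 * ray_integral L (H \<xi>) (\<xi> \<bullet> ?l \<phi>)))"
    proof (rule sphere_integral_swap)
      show "(\<lambda>p. (sin a)\<^sup>2 * (cos_flag_angle (?l (snd (snd p))) (tangent (snd (snd p))) (sph0 (fst p) (fst (snd p))))\<^sup>2 *
           ray_integral L (H (sph0 (fst p) (fst (snd p)))) (sph0 (fst p) (fst (snd p)) \<bullet> ?l (snd (snd p)))) \<in> borel_measurable borel"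
        by (intro borel_measurable_times borel_measurable_power cos_flag_angle_measurable borel_measurable_const
            borel_measurable_continuous_onI ray_H_continuous continuous_intros axes.sph_continuous axes.norm_sph)
      fix \<xi> :: vec3 and \<phi> :: real assume *: "norm \<xi> = 1"
      have "\<bar>ray_integral L (H \<xi>) (\<xi> \<bullet> ?l \<phi>)\<bar> \<le> L * B"
        using L * dot[OF *, of \<phi>] by (intro ray_integral_bound H_continuous continuous_intros B) auto
      hence "\<bar>(sin a)\<^sup>2 * (cos_flag_angle (?l \<phi>) (tangent \<phi>) \<xi>)\<^sup>2 * ray_integral L (H \<xi>) (\<xi> \<bullet> ?l \<phi>)\<bar> \<le> (1 * 1) * (L * B)"
        unfolding abs_mult using k1[of \<phi> \<xi>] s1 by (intro mult_mono) auto
      thus "\<bar>(sin a)\<^sup>2 * (cos_flag_angle (?l \<phi>) (tangent \<phi>) \<xi>)\<^sup>2 * ray_integral L (H \<xi>) (\<xi> \<bullet> ?l \<phi>)\<bar> \<le> L * B" by simp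
    qed
    also have "\<dots> = integral {0..2*pi} (\<lambda>\<phi>. (sin a)\<^sup>2 * sphere_integral (\<lambda>\<xi>. (cos_flag_angle (?l \<phi>) (tangent \<phi>) \<xi>)\<^sup>2 * ray_integral L (H \<xi>) (\<xi> \<bullet> ?l \<phi>)))"
      unfolding sphere_integral_def axes.cap_integral_cmult[symmetric] by (simp only: mult.assoc)
    finally show ?thesis unfolding inner by simp
  qed
  finally show ?thesis unfolding R1i R2i R3i by simp
qed

end

section \<open>Differentiation\<close>

lemma differentiable_curve_compose:
  fixes F :: "'a::real_normed_vector \<Rightarrow> real" and \<gamma> :: "real \<Rightarrow> 'a"
  assumes "(F has_derivative blinfun_apply D) (at (\<gamma> t))" "(\<gamma> has_vector_derivative d) (at t within S)"
  shows "((\<lambda>t. F (\<gamma> t)) has_real_derivative D d) (at t within S)"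
  using has_derivative_compose[OF assms(2)[unfolded has_vector_derivative_def] assms(1)]
  by (simp add: has_field_derivative_def blinfun.scaleR_right mult_commute_abs)

context frame
begin

lemma sph_has_vector_derivative: "(sph c u v \<phi> has_vector_derivative sph' \<phi> \<nu>) (at \<nu> within S)"
  unfolding sph_eq[abs_def] sph'_def has_vector_derivative_def
  by (auto intro!: derivative_eq_intros simp: algebra_simps)

lemma sph_rotate: "cos r *\<^sub>R sph c u v \<phi> \<nu> + sin r *\<^sub>R sph' \<phi> \<nu> = sph c u v \<phi> (\<nu> + r)"
  by (simp add: sph_eq sph'_def cos_add sin_add algebra_simps)

lemma cap_integral_swap_real:
  fixes K :: "vec3 \<Rightarrow> real \<Rightarrow> real"
  assumes K: "continuous_on (sphere 0 1 \<times> UNIV) (\<lambda>p. K (fst p) (snd p))"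
  shows "continuous_on UNIV (\<lambda>r. cap_integral c u v a (\<lambda>s. K s r))"
    and "cap_integral c u v a (\<lambda>s. integral {0..L} (K s)) = integral {0..L} (\<lambda>r. cap_integral c u v a (\<lambda>s. K s r))"
proof -
  define F where "F = (\<lambda>\<phi> \<nu> r. K (sph c u v \<phi> \<nu>) r * sin \<nu>)"
  have Fc: "continuous_on S (\<lambda>z. F (f z) (g z) (k z))"
    if "continuous_on S f" "continuous_on S g" "continuous_on S k" for f g k and S :: "'z::metric_space set"
    unfolding F_def
    using continuous_on_compose2[OF K continuous_on_Pair[OF sph_continuous[OF that(1,2)] that(3)]]
    by (intro continuous_intros that) (simp add: image_subset_iff norm_sph)
  have F1: "continuous_on S (\<lambda>z. integral {0..a} (\<lambda>\<nu>. F (f z) \<nu> (k z)))"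
    if "continuous_on S f" "continuous_on S k" for f k and S :: "'z::metric_space set"
    by (rule continuous_on_real_integral_param)
      (auto intro!: Fc continuous_intros continuous_on_compose2[OF that(1)] continuous_on_compose2[OF that(2)])
  have eq: "cap_integral c u v a (\<lambda>s. K s r) = integral {0..2*pi} (\<lambda>\<phi>. integral {0..a} (\<lambda>\<nu>. F \<phi> \<nu> r))" for r
    by (simp add: cap_integral_def F_def)
  show "continuous_on UNIV (\<lambda>r. cap_integral c u v a (\<lambda>s. K s r))"
    unfolding eq
    by (rule continuous_on_real_integral_param) (auto intro!: F1 continuous_intros)
  have "cap_integral c u v a (\<lambda>s. integral {0..L} (K s)) =
      integral {0..2*pi} (\<lambda>\<phi>. integral {0..a} (\<lambda>\<nu>. integral {0..L} (\<lambda>r. F \<phi> \<nu> r)))"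
    by (simp add: cap_integral_def F_def)
  also have "\<dots> = integral {0..2*pi} (\<lambda>\<phi>. integral {0..L} (\<lambda>r. integral {0..a} (\<lambda>\<nu>. F \<phi> \<nu> r)))"
    by (subst real_integral_swap) (auto intro!: Fc continuous_intros)
  also have "\<dots> = integral {0..L} (\<lambda>r. integral {0..2*pi} (\<lambda>\<phi>. integral {0..a} (\<lambda>\<nu>. F \<phi> \<nu> r)))"
    by (rule real_integral_swap) (auto intro!: F1 continuous_intros)
  finally show "cap_integral c u v a (\<lambda>s. integral {0..L} (K s)) = integral {0..L} (\<lambda>r. cap_integral c u v a (\<lambda>s. K s r))"
    by (simp only: eq)
qed

section \<open>Circle integrals and squared cosines\<close>

definition circle_integral :: "(vec3 \<Rightarrow> real) \<Rightarrow> real \<Rightarrow> real" where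
  "circle_integral f \<nu> = integral {0..2*pi} (\<lambda>\<phi>. f (sph c u v \<phi> \<nu>))"

lemma circle_integral_continuous:
  assumes "continuous_on (sphere 0 1) f"
  shows "continuous_on S (circle_integral f)"
  unfolding circle_integral_def
  by (rule continuous_on_real_integral_param) (intro continuous_on_comp_sph[OF assms] continuous_intros)

lemma cap_integral_circles:
  assumes f: "continuous_on (sphere 0 1) f" and w: "continuous_on UNIV w"
  shows "cap_integral c u v a (\<lambda>s. w (c \<bullet> s) * f s) = integral {0..a} (\<lambda>\<nu>. w (cos \<nu>) * sin \<nu> * circle_integral f \<nu>)"
proof -
  have "cap_integral c u v a (\<lambda>s. w (c \<bullet> s) * f s) =
      integral {0..a} (\<lambda>\<nu>. integral {0..2*pi} (\<lambda>\<phi>. w (cos \<nu>) * f (sph c u v \<phi> \<nu>) * sin \<nu>))"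
    unfolding cap_integral_def c_sph
    by (rule real_integral_swap)
      (intro continuous_intros continuous_on_comp_sph[OF f] continuous_on_compose2[OF w], auto)
  also have "\<dots> = integral {0..a} (\<lambda>\<nu>. w (cos \<nu>) * sin \<nu> * circle_integral f \<nu>)"
    by (simp add: circle_integral_def mult_ac)
  finally show ?thesis .
qed

text \<open>Off the poles the angle between the projection of the point and u is its azimuth. At the
  poles the cosine has the default value 0, but there the area factor sin \<nu> vanishes.\<close>

lemma cap_integral_cos_flag_angle:
  shows "cap_integral c u v a (\<lambda>\<xi>. (cos_flag_angle c u \<xi>)\<^sup>2 * f \<xi>) =
     integral {0..2*pi} (\<lambda>\<phi>. integral {0..a} (\<lambda>\<nu>. (cos \<phi>)\<^sup>2 * (f (sph c u v \<phi> \<nu>) * sin \<nu>)))"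
    and "cap_integral c u v a (\<lambda>\<xi>. (cos_flag_angle c v \<xi>)\<^sup>2 * f \<xi>) =
     integral {0..2*pi} (\<lambda>\<phi>. integral {0..a} (\<lambda>\<nu>. (sin \<phi>)\<^sup>2 * (f (sph c u v \<phi> \<nu>) * sin \<nu>)))"
proof -
  have k: "(cos_flag_angle c w (sph c u v \<phi> \<nu>))\<^sup>2 = (w \<bullet> sph c u v \<phi> \<nu>)\<^sup>2 / (sin \<nu>)\<^sup>2" if "c \<bullet> w = 0" for w \<phi> \<nu>
    using cos_flag_angle_square[OF unit(1) that norm_sph, of \<phi> \<nu>] c_sph[of \<phi> \<nu>]
    by (simp add: inner_commute[of _ c] sin_squared_eq)
  have "u \<bullet> sph c u v \<phi> \<nu> = sin \<nu> * cos \<phi>" "v \<bullet> sph c u v \<phi> \<nu> = sin \<nu> * sin \<phi>" for \<phi> \<nu>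
    by (simp_all add: sph_def inner_add_right dots orth)
  hence e: "(cos_flag_angle c u (sph c u v \<phi> \<nu>))\<^sup>2 * x * sin \<nu> = (cos \<phi>)\<^sup>2 * (x * sin \<nu>)"
    "(cos_flag_angle c v (sph c u v \<phi> \<nu>))\<^sup>2 * x * sin \<nu> = (sin \<phi>)\<^sup>2 * (x * sin \<nu>)" for \<phi> \<nu> x
    using orth by (cases "sin \<nu> = 0"; simp add: k power_mult_distrib)+
  show "cap_integral c u v a (\<lambda>\<xi>. (cos_flag_angle c u \<xi>)\<^sup>2 * f \<xi>) =
     integral {0..2*pi} (\<lambda>\<phi>. integral {0..a} (\<lambda>\<nu>. (cos \<phi>)\<^sup>2 * (f (sph c u v \<phi> \<nu>) * sin \<nu>)))"
    "cap_integral c u v a (\<lambda>\<xi>. (cos_flag_angle c v \<xi>)\<^sup>2 * f \<xi>) =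
     integral {0..2*pi} (\<lambda>\<phi>. integral {0..a} (\<lambda>\<nu>. (sin \<phi>)\<^sup>2 * (f (sph c u v \<phi> \<nu>) * sin \<nu>)))"
    unfolding cap_integral_def e by (rule refl)+
qed

lemma cap_integral_cos_flag_angle_add:
  assumes f: "continuous_on (sphere 0 1) f"
  shows "cap_integral c u v a (\<lambda>\<xi>. (cos_flag_angle c u \<xi>)\<^sup>2 * f \<xi>) + cap_integral c u v a (\<lambda>\<xi>. (cos_flag_angle c v \<xi>)\<^sup>2 * f \<xi>)
    = cap_integral c u v a f"
proof -
  define J where "J = (\<lambda>\<phi>. integral {0..a} (\<lambda>\<nu>. f (sph c u v \<phi> \<nu>) * sin \<nu>))"
  have Jc: "continuous_on S J" for S unfolding J_def by (rule cap_integral_inner_continuous[OF f])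
  have "integral {0..2*pi} (\<lambda>\<phi>. (cos \<phi>)\<^sup>2 * J \<phi>) + integral {0..2*pi} (\<lambda>\<phi>. (sin \<phi>)\<^sup>2 * J \<phi>)
     = integral {0..2*pi} (\<lambda>\<phi>. (cos \<phi>)\<^sup>2 * J \<phi> + (sin \<phi>)\<^sup>2 * J \<phi>)"
    by (intro integral_add[symmetric] integrable_continuous_real continuous_intros Jc)
  also have "\<dots> = integral {0..2*pi} J"
    by (simp add: distrib_right[symmetric])
  finally show ?thesis
    unfolding cap_integral_cos_flag_angle by (simp add: J_def cap_integral_def)
qed

end

text \<open>\<open>F\<close> is the extension of the flag density to a neighbourhood of the flags
  supplied by \<open>C2_on_flags\<close>, and \<open>F'\<close> its derivative, so derivatives along
  curves of flags become an ordinary chain rule.\<close>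

locale smooth_plane_density = plane_density c u v h
  for c u v :: vec3 and h :: "vec3 set \<Rightarrow> real" +
  fixes U :: "(vec3 \<times> vec3 \<times> vec3) set" and F :: "vec3 \<times> vec3 \<times> vec3 \<Rightarrow> real"
    and F' :: "vec3 \<times> vec3 \<times> vec3 \<Rightarrow> (vec3 \<times> vec3 \<times> vec3) \<Rightarrow>\<^sub>L real"
  assumes flags_U: "flags \<subseteq> U"
    and F_deriv: "\<And>z. z \<in> U \<Longrightarrow> (F has_derivative blinfun_apply (F' z)) (at z)"
    and F'_cont: "continuous_on U F'"
    and F_eq: "\<And>x w g. (x, w, g) \<in> flags \<Longrightarrow> F (x, w, g) = flag_density h x w g"
begin

lemma F_cont: "continuous_on U F"
  using F_deriv by (meson continuous_at_imp_continuous_on has_derivative_continuous)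

lemma F_continuous:
  assumes "continuous_on (S :: 'z::metric_space set) f" "\<And>z. z \<in> S \<Longrightarrow> f z \<in> flags"
  shows "continuous_on S (\<lambda>z. F (f z))"
  by (rule continuous_on_compose2[OF F_cont assms(1)]) (use assms(2) flags_U in auto)

lemma F'_continuous:
  assumes "continuous_on (S :: 'z::metric_space set) f" "continuous_on S d" "\<And>z. z \<in> S \<Longrightarrow> f z \<in> flags"
  shows "continuous_on S (\<lambda>z. F' (f z) (d z))"
  by (intro continuous_intros continuous_on_compose2[OF F'_cont assms(1)] assms(2)) (use assms(3) flags_U in auto)

lemma F_curve_deriv:
  assumes "(\<gamma> has_vector_derivative d) (at t within S)" "\<gamma> t \<in> flags"
  shows "((\<lambda>t. F (\<gamma> t)) has_real_derivative F' (\<gamma> t) d) (at t within S)"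
  by (rule differentiable_curve_compose[where \<gamma> = \<gamma>, OF F_deriv assms(1)]) (use assms(2) flags_U in blast)

abbreviation "M \<equiv> bundle_mass h"
abbreviation "\<rho> \<equiv> flag_density h"

lemma axes_flags: "(x, axis 3 1, axis 1 1) \<in> flags" "(x, axis 3 1, axis 2 1) \<in> flags"
  by (auto simp: flags_def inner_axis_axis)

text \<open>The source of the differentiability of M, which a merely continuous h does not provide:
  the squared cosines for two orthogonal lines in one plane add up to 1 almost everywhere. The
  coordinate axes are chosen because \<open>sphere_integral\<close> is written in them.\<close>

lemma M_eq: "M x = F (x, axis 3 1, axis 1 1) + F (x, axis 3 1, axis 2 1)"
proof -
  have "continuous_on (sphere 0 1) (\<lambda>\<xi>. H \<xi> (\<xi> \<bullet> x))"
    by (intro H_continuous continuous_intros) auto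
  from axes.cap_integral_cos_flag_angle_add[OF this, of pi]
  have "2 * \<rho> x (axis 3 1) (axis 1 1) + 2 * \<rho> x (axis 3 1) (axis 2 1) = 2 * M x"
    unfolding bundle_mass_eq[symmetric] flag_density_eq[symmetric] sphere_integral_def .
  thus ?thesis by (simp add: F_eq axes_flags)
qed

definition M' where "M' x d = F' (x, axis 3 1, axis 1 1) (d, 0, 0) + F' (x, axis 3 1, axis 2 1) (d, 0, 0)"

lemma M_continuous:
  assumes "continuous_on (S :: 'z::metric_space set) f"
  shows "continuous_on S (\<lambda>z. M (f z))"
  unfolding M_eq by (intro continuous_intros F_continuous assms axes_flags)

lemma M'_continuous:
  assumes "continuous_on (S :: 'z::metric_space set) f" "continuous_on S d"
  shows "continuous_on S (\<lambda>z. M' (f z) (d z))"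
  unfolding M'_def by (intro continuous_intros F'_continuous assms axes_flags)

lemma M_ray_deriv: "((\<lambda>r. M (x + r *\<^sub>R d)) has_real_derivative M' (x + r *\<^sub>R d) d) (at r within S)"
proof -
  have "((\<lambda>r. (x + r *\<^sub>R d, w)) has_vector_derivative (d, 0)) (at r within S)" for w :: "vec3 \<times> vec3"
    unfolding has_vector_derivative_def by (auto intro!: derivative_eq_intros)
  thus ?thesis unfolding M_eq M'_def
    by (intro DERIV_add F_curve_deriv axes_flags) (simp_all add: zero_prod_def)
qed

lemma deriv_M: "deriv (\<lambda>t. M (s + t *\<^sub>R s)) 0 = M' s s"
  using M_ray_deriv[of s s 0] by (intro DERIV_imp_deriv) simp

lemma flag_mem: "(x, sph c u v \<phi> a, tangent \<phi>) \<in> flags"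
  by (simp add: flags_def norm_sph norm_tangent tangent_dots)

lemma \<rho>_sph: "\<rho> x (sph c u v \<phi> a) (tangent \<phi>) = F (x, sph c u v \<phi> a, tangent \<phi>)"
  by (rule F_eq[OF flag_mem, symmetric])

text \<open>The derivative of \<open>integrated_identity\<close> in L at 1. All its terms are
  integrals over {0..L}, and \<open>A\<close> is the continuous combination of their integrands, so
  it vanishes at 1.\<close>

lemma radial_identity:
  assumes a: "0 < a" "a < pi"
  shows "(sin a)\<^sup>2 * integral {0..2*pi} (\<lambda>\<phi>. \<rho> (sph c u v \<phi> a) (sph c u v \<phi> a) (tangent \<phi>)) =
     cap_integral c u v a (\<lambda>s. (c \<bullet> s) * M s)
     + cap_integral c u v a (\<lambda>s. (c \<bullet> s - cos a) * (M s + M' s s))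
     - 2 * pi * cap_integral c u v a (\<lambda>s. (c \<bullet> s - cos a) * H s 1)"
proof -
  define P where "P = (\<lambda>r. integral {0..2*pi} (\<lambda>\<phi>. \<rho> (r *\<^sub>R sph c u v \<phi> a) (sph c u v \<phi> a) (tangent \<phi>)))"
  define C1 where "C1 = (\<lambda>r. cap_integral c u v a (\<lambda>s. (c \<bullet> s) * M (r *\<^sub>R s)))"
  \<comment> \<open>The integrand contains the r-derivative of r M(r s), which turns the boundary
    term L M(L s) into an integral over r.\<close>
  define C2 where "C2 = (\<lambda>r. cap_integral c u v a (\<lambda>s. (c \<bullet> s - cos a) * (M (r *\<^sub>R s) + r * M' (r *\<^sub>R s) s)))"
  define C3 where "C3 = (\<lambda>r. cap_integral c u v a (\<lambda>s. (c \<bullet> s - cos a) * H s r))"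
  define A where "A = (\<lambda>r. (sin a)\<^sup>2 * P r - C1 r - C2 r + 2 * pi * C3 r)"
  have K1: "continuous_on (sphere 0 1 \<times> UNIV) (\<lambda>p. (c \<bullet> fst p) * M (snd p *\<^sub>R fst p))"
    by (intro continuous_intros M_continuous)
  have K2: "continuous_on (sphere 0 1 \<times> UNIV) (\<lambda>p. (c \<bullet> fst p - cos a) * (M (snd p *\<^sub>R fst p) + snd p * M' (snd p *\<^sub>R fst p) (fst p)))"
    by (intro continuous_intros M_continuous M'_continuous)
  have K3: "continuous_on (sphere 0 1 \<times> UNIV) (\<lambda>p. (c \<bullet> fst p - cos a) * H (fst p) (snd p))"
    by (intro continuous_intros H_continuous) auto
  have Pc: "continuous_on UNIV P"
    unfolding P_def \<rho>_sph
    by (rule continuous_on_real_integral_param)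
      (intro continuous_intros F_continuous flag_mem sph_continuous tangent_continuous)
  have C1c: "continuous_on UNIV C1" unfolding C1_def by (rule cap_integral_swap_real(1)[OF K1])
  have C2c: "continuous_on UNIV C2" unfolding C2_def by (rule cap_integral_swap_real(1)[OF K2])
  have C3c: "continuous_on UNIV C3" unfolding C3_def by (rule cap_integral_swap_real(1)[OF K3])
  note cont = continuous_on_subset[OF Pc subset_UNIV] continuous_on_subset[OF C1c subset_UNIV]
    continuous_on_subset[OF C2c subset_UNIV] continuous_on_subset[OF C3c subset_UNIV]
  have Ac: "continuous_on S A" for S unfolding A_def by (intro continuous_intros cont)
  have A0: "integral {0..L} A = 0" if L: "L > 0" for L
  proof -
    have "integral {0..L} P = integral {0..2*pi} (\<lambda>\<phi>. integral {0..L} (\<lambda>r. \<rho> (r *\<^sub>R sph c u v \<phi> a) (sph c u v \<phi> a) (tangent \<phi>)))"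
      unfolding P_def \<rho>_sph
      by (rule real_integral_swap) (intro continuous_intros F_continuous flag_mem sph_continuous tangent_continuous)
    moreover have "integral {0..L} C1 = cap_integral c u v a (\<lambda>s. (c \<bullet> s) * integral {0..L} (\<lambda>r. M (r *\<^sub>R s)))"
      unfolding C1_def by (subst cap_integral_swap_real(2)[OF K1, symmetric]) simp
    moreover have "integral {0..L} C3 = cap_integral c u v a (\<lambda>s. (c \<bullet> s - cos a) * integral {0..L} (H s))"
      unfolding C3_def by (subst cap_integral_swap_real(2)[OF K3, symmetric]) simp
    moreover have "integral {0..L} C2 = L * cap_integral c u v a (\<lambda>s. (c \<bullet> s - cos a) * M (L *\<^sub>R s))"
    proof -
      have "integral {0..L} (\<lambda>r. M (r *\<^sub>R s) + r * M' (r *\<^sub>R s) s) = L * M (L *\<^sub>R s)" for s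
      proof -
        have "integral {0..L} (\<lambda>r. M (r *\<^sub>R s) + r * M' (r *\<^sub>R s) s) = L * M (L *\<^sub>R s) - 0 * M (0 *\<^sub>R s)"
          using L M_ray_deriv[of 0 s _ UNIV]
          by (intro integral_deriv_eq) (auto intro!: derivative_eq_intros)
        thus ?thesis by simp
      qed
      hence "integral {0..L} C2 = cap_integral c u v a (\<lambda>s. L * ((c \<bullet> s - cos a) * M (L *\<^sub>R s)))"
        unfolding C2_def by (subst cap_integral_swap_real(2)[OF K2, symmetric]) (simp add: mult.left_commute)
      thus ?thesis by (simp only: cap_integral_cmult)
    qed
    moreover have "integral {0..L} A = (sin a)\<^sup>2 * integral {0..L} P - integral {0..L} C1 - integral {0..L} C2 + 2 * pi * integral {0..L} C3"
    proof -
      have "((\<lambda>r. (sin a)\<^sup>2 * P r - C1 r - C2 r + (2 * pi) * C3 r) has_integral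
         (sin a)\<^sup>2 * integral {0..L} P - integral {0..L} C1 - integral {0..L} C2 + (2 * pi) * integral {0..L} C3) {0..L}"
        by (intro has_integral_add has_integral_diff has_integral_mult_right integrable_integral integrable_continuous_real cont)
      thus ?thesis unfolding A_def by (rule integral_unique)
    qed
    ultimately show ?thesis using integrated_identity[OF a L] by simp
  qed
  \<comment> \<open>The derivative at 1 is \<open>A 1\<close> by the fundamental theorem and 0
    because the integral vanishes for all positive L. The interval {0..2} only serves to have 1 in
    its interior.\<close>
  have "((\<lambda>L. integral {0..L} A) has_real_derivative A 1) (at 1 within {0..2})"
    by (rule integral_has_real_derivative[OF Ac]) simp
  hence "((\<lambda>L. integral {0..L} A) has_real_derivative A 1) (at 1)"
    by (simp add: at_within_Icc_at)
  moreover have "((\<lambda>L. integral {0..L} A) has_real_derivative 0) (at 1)"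
    by (rule has_field_derivative_transform_within_open[where S = "{0<..}" and f = "\<lambda>_. 0"]) (auto simp: A0)
  ultimately have "A 1 = 0" by (rule DERIV_unique)
  thus ?thesis by (simp add: A_def P_def C1_def C2_def C3_def)
qed

lemma rho_Phi_eq: "rho_Phi \<rho> (sph c u v \<phi> a) (sph c u v \<phi> a) (tangent \<phi>) =
    F' (sph c u v \<phi> a, sph c u v \<phi> a, tangent \<phi>) (0, sph' \<phi> a, 0)"
proof -
  have sd: "((\<lambda>t. sph c u v \<phi> (a + t)) has_vector_derivative sph' \<phi> (a + 0)) (at 0)"
    unfolding sph_eq[abs_def] sph'_def has_vector_derivative_def
    by (auto intro!: derivative_eq_intros simp: algebra_simps)
  have "((\<lambda>t. (sph c u v \<phi> a, sph c u v \<phi> (a + t), tangent \<phi>)) has_vector_derivative (0, sph' \<phi> a, 0)) (at 0)"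
    using sd by (auto intro!: has_vector_derivative_Pair)
  from F_curve_deriv[OF this] show ?thesis
    unfolding rho_Phi_def cross_tangent_sph sph_rotate \<rho>_sph
    by (intro DERIV_imp_deriv) (simp add: flag_mem)
qed

lemma rho_y_eq: "rho_y \<rho> (sph c u v \<phi> a) (sph c u v \<phi> a) (tangent \<phi>) =
    F' (sph c u v \<phi> a, sph c u v \<phi> a, tangent \<phi>) (sph' \<phi> a, 0, 0)"
proof -
  have "((\<lambda>t. (sph c u v \<phi> a + t *\<^sub>R sph' \<phi> a, sph c u v \<phi> a, tangent \<phi>)) has_vector_derivative (sph' \<phi> a, 0, 0)) (at 0)"
    unfolding has_vector_derivative_def by (auto intro!: derivative_eq_intros simp: zero_prod_def)
  from F_curve_deriv[OF this] show ?thesis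
    unfolding rho_y_def cross_tangent_sph \<rho>_sph
    by (intro DERIV_imp_deriv) (simp add: flag_mem)
qed

text \<open>Along a meridian the line direction \<open>tangent \<phi>\<close> is constant, while
  location and normal move with the same velocity \<open>sph'\<close>. Linearity of
  \<open>F'\<close> separates the two motions.\<close>

lemma circle_density_deriv:
  "((\<lambda>a. integral {0..2*pi} (\<lambda>\<phi>. \<rho> (sph c u v \<phi> a) (sph c u v \<phi> a) (tangent \<phi>))) has_real_derivative
     integral {0..2*pi} (\<lambda>\<phi>. rho_Phi \<rho> (sph c u v \<phi> a) (sph c u v \<phi> a) (tangent \<phi>))
   + integral {0..2*pi} (\<lambda>\<phi>. rho_y \<rho> (sph c u v \<phi> a) (sph c u v \<phi> a) (tangent \<phi>))) (at a)"
proof -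
  have d: "((\<lambda>a. F (sph c u v \<phi> a, sph c u v \<phi> a, tangent \<phi>)) has_real_derivative
      F' (sph c u v \<phi> a, sph c u v \<phi> a, tangent \<phi>) (sph' \<phi> a, sph' \<phi> a, 0)) (at a)" for \<phi> a
    by (intro F_curve_deriv has_vector_derivative_Pair sph_has_vector_derivative flag_mem) auto
  have "((\<lambda>a. integral (cbox 0 (2*pi)) (\<lambda>\<phi>. F (sph c u v \<phi> a, sph c u v \<phi> a, tangent \<phi>))) has_real_derivative
     integral (cbox 0 (2*pi)) (\<lambda>\<phi>. F' (sph c u v \<phi> a, sph c u v \<phi> a, tangent \<phi>) (sph' \<phi> a, sph' \<phi> a, 0))) (at a within UNIV)"
  proof (rule leibniz_rule_field_derivative)
    show "continuous_on (UNIV \<times> cbox 0 (2 * pi)) (\<lambda>(a, \<phi>). F' (sph c u v \<phi> a, sph c u v \<phi> a, tangent \<phi>) (sph' \<phi> a, sph' \<phi> a, 0))"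
      unfolding case_prod_unfold
      by (intro F'_continuous continuous_intros sph_continuous sph'_continuous tangent_continuous flag_mem)
    show "(\<lambda>\<phi>. F (sph c u v \<phi> a, sph c u v \<phi> a, tangent \<phi>)) integrable_on cbox 0 (2 * pi)" for a
      by (intro integrable_continuous F_continuous continuous_intros sph_continuous tangent_continuous flag_mem)
  qed (use d in auto)
  moreover have "integral {0..2*pi} (\<lambda>\<phi>. F' (sph c u v \<phi> a, sph c u v \<phi> a, tangent \<phi>) (sph' \<phi> a, sph' \<phi> a, 0)) =
     integral {0..2*pi} (\<lambda>\<phi>. rho_Phi \<rho> (sph c u v \<phi> a) (sph c u v \<phi> a) (tangent \<phi>))
   + integral {0..2*pi} (\<lambda>\<phi>. rho_y \<rho> (sph c u v \<phi> a) (sph c u v \<phi> a) (tangent \<phi>))"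
  proof -
    have "F' z (x, x, 0) = F' z (0, x, 0) + F' z (x, 0, 0)" for z x
      by (simp add: blinfun.add_right[symmetric])
    thus ?thesis unfolding rho_Phi_eq rho_y_eq
      by (simp only:) (intro integral_add integrable_continuous_real F'_continuous continuous_intros
          sph_continuous sph'_continuous tangent_continuous flag_mem)
  qed
  ultimately show ?thesis by (simp add: \<rho>_sph)
qed

theorem disc_identity:
  assumes a: "0 < a" "a < pi"
  shows "2 * sin a * cos a * integral {0..2*pi} (\<lambda>\<phi>. \<rho> (sph c u v \<phi> a) (sph c u v \<phi> a) (tangent \<phi>))
     + (sin a)\<^sup>2 * (integral {0..2*pi} (\<lambda>\<phi>. rho_Phi \<rho> (sph c u v \<phi> a) (sph c u v \<phi> a) (tangent \<phi>))
       + integral {0..2*pi} (\<lambda>\<phi>. rho_y \<rho> (sph c u v \<phi> a) (sph c u v \<phi> a) (tangent \<phi>)))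
     = sin a * cos a * integral {0..2*pi} (\<lambda>\<phi>. M (sph c u v \<phi> a))
     + sin a * (cap_integral c u v a M + cap_integral c u v a (\<lambda>s. M' s s) - 2 * pi * cap_integral c u v a (\<lambda>s. H s 1))"
proof -
  \<comment> \<open>\<open>G\<close> collects everything in \<open>radial_identity\<close> that
    carries the weight cos \<nu> - cos b.\<close>
  define G where "G = (\<lambda>s. M s + M' s s + (- 2 * pi) * H s 1)"
  have Mc: "continuous_on (sphere 0 1) M" by (intro M_continuous continuous_intros)
  have M'c: "continuous_on (sphere 0 1) (\<lambda>s. M' s s)" by (intro M'_continuous continuous_intros)
  have Hc: "continuous_on (sphere 0 1) (\<lambda>s. H s 1)" by (intro H_continuous continuous_intros) auto
  have Gc: "continuous_on (sphere 0 1) G" unfolding G_def by (intro continuous_intros Mc M'c Hc)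
  have cint: "continuous_on S (circle_integral f)" if "continuous_on (sphere 0 1) f" for f S
    by (rule circle_integral_continuous[OF that])
  let ?P = "\<lambda>a. integral {0..2*pi} (\<lambda>\<phi>. \<rho> (sph c u v \<phi> a) (sph c u v \<phi> a) (tangent \<phi>))"
  let ?I = "\<lambda>a. integral {0..a} (\<lambda>\<nu>. sin \<nu> * circle_integral G \<nu>)"
  let ?J = "\<lambda>a. integral {0..a} (\<lambda>\<nu>. cos \<nu> * sin \<nu> * (circle_integral G \<nu> + circle_integral M \<nu>))"
  \<comment> \<open>Splitting the weight cos \<nu> - cos b leaves b only in the limits and in the
    outer factor cos b, so the fundamental theorem suffices for the right-hand side.\<close>
  have eq: "(sin b)\<^sup>2 * ?P b = ?J b - cos b * ?I b" if b: "b \<in> {0<..<pi}" for b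
  proof -
    have w: "continuous_on UNIV (\<lambda>m. m - cos b)" by (intro continuous_intros)
    have "cap_integral c u v b (\<lambda>s. (c \<bullet> s - cos b) * (M s + M' s s)) + (- 2 * pi) * cap_integral c u v b (\<lambda>s. (c \<bullet> s - cos b) * H s 1)
       = cap_integral c u v b (\<lambda>s. (c \<bullet> s - cos b) * (M s + M' s s) + (- 2 * pi) * ((c \<bullet> s - cos b) * H s 1))"
      unfolding cap_integral_cmult[symmetric]
      by (intro cap_integral_add[symmetric] continuous_intros Mc M'c Hc)
    also have "\<dots> = cap_integral c u v b (\<lambda>s. (c \<bullet> s - cos b) * G s)"
      by (simp add: G_def algebra_simps)
    finally have "(sin b)\<^sup>2 * ?P b = cap_integral c u v b (\<lambda>s. (c \<bullet> s) * M s) + cap_integral c u v b (\<lambda>s. (c \<bullet> s - cos b) * G s)"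
      using radial_identity[of b] b by simp
    also have "\<dots> = integral {0..b} (\<lambda>\<nu>. cos \<nu> * sin \<nu> * circle_integral M \<nu>) + integral {0..b} (\<lambda>\<nu>. (cos \<nu> - cos b) * sin \<nu> * circle_integral G \<nu>)"
      using cap_integral_circles[OF Mc continuous_on_id, of b] cap_integral_circles[OF Gc w, of b] by simp
    also have "\<dots> = ?J b - cos b * ?I b"
      unfolding integral_mult_right[symmetric]
      by (subst integral_add[symmetric], (intro integrable_continuous_real continuous_intros cint Mc Gc)+,
          subst integral_diff[symmetric], (intro integrable_continuous_real continuous_intros cint Mc Gc)+)
        (auto intro!: integral_cong simp: algebra_simps)
    finally show ?thesis .
  qed
  have within: "at a within {0..pi} = at a" using a by (simp add: at_within_Icc_at)
  have dI: "(?I has_real_derivative sin a * circle_integral G a) (at a)"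
    using integral_has_real_derivative[of 0 pi "\<lambda>\<nu>. sin \<nu> * circle_integral G \<nu>" a] a
    by (simp add: within continuous_intros cint Gc)
  have dJ: "(?J has_real_derivative cos a * sin a * (circle_integral G a + circle_integral M a)) (at a)"
    using integral_has_real_derivative[of 0 pi "\<lambda>\<nu>. cos \<nu> * sin \<nu> * (circle_integral G \<nu> + circle_integral M \<nu>)" a] a
    by (simp add: within continuous_intros cint Gc Mc)
  \<comment> \<open>The circle integrals of \<open>G\<close> cancel, since the weight vanishes on
    the boundary circle. What remains is the circle integral of M and sin a times the cap integral
    of \<open>G\<close>.\<close>
  have d1: "((\<lambda>b. ?J b - cos b * ?I b) has_real_derivative
      cos a * sin a * (circle_integral G a + circle_integral M a) - (cos a * (sin a * circle_integral G a) + (- sin a) * ?I a)) (at a)"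
    by (rule derivative_eq_intros dI dJ refl | simp)+
  have d2: "((\<lambda>b. (sin b)\<^sup>2 * ?P b) has_real_derivative
      2 * sin a * cos a * ?P a + (sin a)\<^sup>2 * (integral {0..2*pi} (\<lambda>\<phi>. rho_Phi \<rho> (sph c u v \<phi> a) (sph c u v \<phi> a) (tangent \<phi>))
       + integral {0..2*pi} (\<lambda>\<phi>. rho_y \<rho> (sph c u v \<phi> a) (sph c u v \<phi> a) (tangent \<phi>)))) (at a)"
    by (rule derivative_eq_intros circle_density_deriv refl | simp)+
  have "((\<lambda>b. ?J b - cos b * ?I b) has_real_derivative
      2 * sin a * cos a * ?P a + (sin a)\<^sup>2 * (integral {0..2*pi} (\<lambda>\<phi>. rho_Phi \<rho> (sph c u v \<phi> a) (sph c u v \<phi> a) (tangent \<phi>))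
       + integral {0..2*pi} (\<lambda>\<phi>. rho_y \<rho> (sph c u v \<phi> a) (sph c u v \<phi> a) (tangent \<phi>)))) (at a)"
    by (rule has_field_derivative_transform_within_open[OF d2, where S = "{0<..<pi}"]) (use a eq in auto)
  note D = DERIV_unique[OF this d1]
  have I: "?I a = cap_integral c u v a M + cap_integral c u v a (\<lambda>s. M' s s) - 2 * pi * cap_integral c u v a (\<lambda>s. H s 1)"
  proof -
    have "?I a = cap_integral c u v a G"
      using cap_integral_circles[OF Gc, of "\<lambda>_. 1" a] by simp
    also have "\<dots> = cap_integral c u v a M + cap_integral c u v a (\<lambda>s. M' s s) + (- 2 * pi) * cap_integral c u v a (\<lambda>s. H s 1)"
      unfolding G_def by (simp only: cap_integral_add cap_integral_cmult Mc M'c Hc continuous_intros)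
    finally show ?thesis by simp
  qed
  have "circle_integral M a = integral {0..2*pi} (\<lambda>\<phi>. M (sph c u v \<phi> a))"
    by (simp add: circle_integral_def)
  with D[unfolded I] show ?thesis by (simp add: algebra_simps)
qed

end

theorem theorem5:
  fixes h :: "vec3 set \<Rightarrow> real" and c u v :: vec3 and \<alpha> :: real
  assumes h_cont: "continuous_on (sphere 0 1 \<times> UNIV) (\<lambda>z. h (plane (fst z) (snd z)))"
    and rho_C2: "C2_on_flags (flag_density h)"
    and frame: "norm c = 1" "norm u = 1" "norm v = 1" "c \<bullet> u = 0" "c \<bullet> v = 0" "u \<bullet> v = 0"
    and alpha: "0 < \<alpha>" "\<alpha> < pi / 2"
  defines "M \<equiv> bundle_mass h"
    and "\<rho> \<equiv> flag_density h"
    and "l \<equiv> (\<lambda>\<phi>. sph c u v \<phi> \<alpha>)"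
  shows "2 * pi * cap_integral c u v \<alpha> (hstar h)
       = cap_integral c u v \<alpha> M
         + cap_integral c u v \<alpha> (\<lambda>s. deriv (\<lambda>t. M (s + t *\<^sub>R s)) 0)
         + cos \<alpha> * integral {0..2*pi} (\<lambda>\<phi>. M (l \<phi>))
         - sin \<alpha> * integral {0..2*pi} (\<lambda>\<phi>. rho_Phi \<rho> (l \<phi>) (l \<phi>) (tangent_dir c (l \<phi>)))
         - 2 * cos \<alpha> * integral {0..2*pi} (\<lambda>\<phi>. \<rho> (l \<phi>) (l \<phi>) (tangent_dir c (l \<phi>)))
         - sin \<alpha> * integral {0..2*pi} (\<lambda>\<phi>. rho_y \<rho> (l \<phi>) (l \<phi>) (tangent_dir c (l \<phi>)))"
proof -
  obtain U F F' F'' where UF: "flags \<subseteq> U" "\<And>z. z \<in> U \<Longrightarrow> (F has_derivative blinfun_apply (F' z)) (at z)"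
    "\<And>z. z \<in> U \<Longrightarrow> (F' has_derivative blinfun_apply (F'' z)) (at z)"
    "\<And>x w g. (x, w, g) \<in> flags \<Longrightarrow> F (x, w, g) = flag_density h x w g"
    using rho_C2 unfolding C2_on_flags_def C2_on_def by blast
  have "continuous_on U F'"
    using UF(3) by (meson continuous_at_imp_continuous_on has_derivative_continuous)
  then interpret smooth_plane_density c u v h U F F'
    using h_cont frame UF by unfold_locales auto
  have a: "0 < \<alpha>" "\<alpha> < pi" using alpha by auto
  \<comment> \<open>\<open>disc_identity\<close> solved for the tangent planes. It still carries the
    factor sin \<alpha> produced by differentiating the weight; this is positive and cancels in the
    next step.\<close>
  have "sin \<alpha> * (2 * pi * cap_integral c u v \<alpha> (\<lambda>s. H s 1))
     = sin \<alpha> * (cap_integral c u v \<alpha> M + cap_integral c u v \<alpha> (\<lambda>s. M' s s)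
         + cos \<alpha> * integral {0..2*pi} (\<lambda>\<phi>. M (l \<phi>))
         - sin \<alpha> * integral {0..2*pi} (\<lambda>\<phi>. rho_Phi \<rho> (l \<phi>) (l \<phi>) (tangent \<phi>))
         - 2 * cos \<alpha> * integral {0..2*pi} (\<lambda>\<phi>. \<rho> (l \<phi>) (l \<phi>) (tangent \<phi>))
         - sin \<alpha> * integral {0..2*pi} (\<lambda>\<phi>. rho_y \<rho> (l \<phi>) (l \<phi>) (tangent \<phi>)))"
    using disc_identity[OF a] unfolding M_def \<rho>_def l_def by (simp add: power2_eq_square algebra_simps)
  hence "2 * pi * cap_integral c u v \<alpha> (\<lambda>s. H s 1)
     = cap_integral c u v \<alpha> M + cap_integral c u v \<alpha> (\<lambda>s. M' s s)
         + cos \<alpha> * integral {0..2*pi} (\<lambda>\<phi>. M (l \<phi>))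
         - sin \<alpha> * integral {0..2*pi} (\<lambda>\<phi>. rho_Phi \<rho> (l \<phi>) (l \<phi>) (tangent \<phi>))
         - 2 * cos \<alpha> * integral {0..2*pi} (\<lambda>\<phi>. \<rho> (l \<phi>) (l \<phi>) (tangent \<phi>))
         - sin \<alpha> * integral {0..2*pi} (\<lambda>\<phi>. rho_y \<rho> (l \<phi>) (l \<phi>) (tangent \<phi>))"
    using sin_gt_zero[OF a] by simp
  moreover have "hstar h = (\<lambda>s. H s 1)" by (simp add: hstar_def[abs_def] H_def)
  ultimately show ?thesis
    unfolding M_def \<rho>_def l_def deriv_M tangent_dir_sph[OF a] by simp
qed

end
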